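(* Let $k>0$ and $\varphi(p)=e^{kp^0}$. There is a constant $C>0$, depending only on the scattering kernel, such that for every non-negative measurable function $f$ on $[0,1]\times\mathbb{R}^3$ and every $a\in\mathbb{R}^3$, $$\int_{\mathbb{R}^3}\frac{\varphi(p)}{|p-a|}\,\|Q^+(f,f)(\cdot,p)\|_{L^\infty_{x_1}([0,1])}\,dp\le C\,\|f\|^2 .$$ In particular $C$ is independent of $a$.
   Context: Notation. For $p\in\mathbb{R}^3$: $p^0=\sqrt{1+|p|^2}$. For $p,q\in\mathbb{R}^3$: $g=g(p,q)=\sqrt{|p-q|^2-(p^0-q^0)^2}$, $s=g^2+4$, $v_{\o}=\dfrac{g\sqrt s}{p^0q^0}$. Collisions. For $\omega\in\mathbb{S}^2$ and $\gamma=(p^0+q^0)/\sqrt s$, $$p'=\tfrac{p+q}2+\tfrac g2\Big(\omega+(\gamma-1)(p+q)\tfrac{(p+q)\cdot\omega}{|p+q|^2}\Big),\qquad q'=\tfrac{p+q}2-\tfrac g2\Big(\omega+(\gamma-1)(p+q)\tfrac{(p+q)\cdot\omega}{|p+q|^2}\Big),$$ and the scattering angle $\theta$ is given by $\cos\theta=g^{-2}\big[-(p^0-q^0)(p'^0-q'^0)+(p-q)\cdot(p'-q')\big]$. Scattering kernel (hard spheres). $\sigma(g,\theta)\ge0$ is measurable with $\sigma(g,\theta)\approx g\,\sigma_0(\theta)$ (two-sided bounds with fixed positive constants), where $0\le\sigma_0(\theta)\le\frac1{4\pi}$ is measurable and $\int_{\mathbb{S}^2}\sigma_0(\theta)\,d\omega=c_0\le1$.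 Gain operator: $Q^+(f,h)(x_1,p)=\int_{\mathbb{R}^3}\int_{\mathbb{S}^2}v_{\o}\,\sigma(g,\theta)f(x_1,p')h(x_1,q')\,d\omega\,dq$. Norms: $\|u(\cdot,p)\|_{L^\infty_{x_1}}=\operatorname{ess\,sup}_{x_1\in[0,1]}|u(x_1,p)|$ and $\|f\|=\int_{\mathbb{R}^3}(p^0)^{1/2}\varphi(p)\|f(\cdot,p)\|_{L^\infty_{x_1}}dp$. *)

theory Defs
  imports "HOL-Analysis.Analysis" "HOL-Probability.Essential_Supremum"
begin

definition energy :: "real ^ 3 \<Rightarrow> real" where
  "energy p = sqrt (1 + (norm p)\<^sup>2)"

definition rel_momentum :: "real ^ 3 \<Rightarrow> real ^ 3 \<Rightarrow> real" where
  "rel_momentum p q = sqrt ((norm (p - q))\<^sup>2 - (energy p - energy q)\<^sup>2)"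

definition cm_energy_sq :: "real ^ 3 \<Rightarrow> real ^ 3 \<Rightarrow> real" where
  "cm_energy_sq p q = (rel_momentum p q)\<^sup>2 + 4"

definition moller_velocity :: "real ^ 3 \<Rightarrow> real ^ 3 \<Rightarrow> real" where
  "moller_velocity p q =
     rel_momentum p q * sqrt (cm_energy_sq p q) / (energy p * energy q)"

definition lorentz_factor :: "real ^ 3 \<Rightarrow> real ^ 3 \<Rightarrow> real" where
  "lorentz_factor p q = (energy p + energy q) / sqrt (cm_energy_sq p q)"

text \<open>If \<open>p + q = 0\<close>, division by zero makes the second summand vanish; this is the right
  value, because the Lorentz factor is then 1.\<close>

definition collision_dir :: "real ^ 3 \<Rightarrow> real ^ 3 \<Rightarrow> real ^ 3 \<Rightarrow> real ^ 3" where
  "collision_dir p q \<omega> =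
     \<omega> + ((lorentz_factor p q - 1) * (((p + q) \<bullet> \<omega>) / (norm (p + q))\<^sup>2)) *\<^sub>R (p + q)"

definition post_p :: "real ^ 3 \<Rightarrow> real ^ 3 \<Rightarrow> real ^ 3 \<Rightarrow> real ^ 3" where
  "post_p p q \<omega> = (1/2) *\<^sub>R (p + q) + (rel_momentum p q / 2) *\<^sub>R collision_dir p q \<omega>"

definition post_q :: "real ^ 3 \<Rightarrow> real ^ 3 \<Rightarrow> real ^ 3 \<Rightarrow> real ^ 3" where
  "post_q p q \<omega> = (1/2) *\<^sub>R (p + q) - (rel_momentum p q / 2) *\<^sub>R collision_dir p q \<omega>"

text \<open>Meaningful for \<open>p \<noteq> q\<close> only; for \<open>p = q\<close> we have \<open>g = 0\<close>.\<close>

definition scattering_angle :: "real ^ 3 \<Rightarrow> real ^ 3 \<Rightarrow> real ^ 3 \<Rightarrow> real" where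
  "scattering_angle p q \<omega> = arccos
     ((- (energy p - energy q) * (energy (post_p p q \<omega>) - energy (post_q p q \<omega>))
       + (p - q) \<bullet> (post_p p q \<omega> - post_q p q \<omega>)) / (rel_momentum p q)\<^sup>2)"

text \<open>The surface measure \<open>d\<omega>\<close> on the unit sphere, as the cone measure: the area of \<open>A\<close> is
  3 times the volume of \<open>{r\<omega> | 0 < r < 1, \<omega> \<in> A}\<close>. Note that \<open>sgn x = x / |x|\<close>.\<close>

definition sphere_measure :: "(real ^ 3) measure" where
  "sphere_measure = scale_measure 3
     (distr (restrict_space lborel (ball 0 1 - {0})) (restrict_space borel (sphere 0 1)) sgn)"

lemma space_sphere_measure: "space sphere_measure = sphere 0 1"
  by (simp add: sphere_measure_def space_scale_measure space_restrict_space)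

lemma emeasure_sphere_measure_total:
  "emeasure sphere_measure (sphere 0 1) = ennreal (4 * pi)"
proof -
  let ?M = "restrict_space lborel (ball 0 1 - {0}) :: (real ^ 3) measure"
  let ?N = "restrict_space borel (sphere 0 1) :: (real ^ 3) measure"
  have borel: "ball 0 1 - {0::real^3} \<in> sets lborel"
    by (metis borel_open open_ball open_delete sets_lborel)
  have meas: "sgn \<in> ?M \<rightarrow>\<^sub>M ?N"
  proof (rule measurable_restrict_space2)
    show "sgn \<in> space ?M \<rightarrow> sphere 0 1"
      by (auto simp: space_restrict_space norm_sgn)
    show "sgn \<in> ?M \<rightarrow>\<^sub>M (borel :: (real^3) measure)"
      unfolding sgn_div_norm by (rule measurable_restrict_space1) measurable
  qed
  have "emeasure (distr ?M ?N sgn) (sphere 0 1) = emeasure ?M (sgn -` sphere 0 1 \<inter> space ?M)"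
    by (rule emeasure_distr[OF meas]) (auto simp: sets_restrict_space)
  also have "sgn -` sphere 0 1 \<inter> space ?M = ball 0 1 - {0}"
    by (auto simp: space_restrict_space norm_sgn)
  also have "emeasure ?M \<dots> = emeasure lborel (ball 0 1 - {0::real^3})"
    using borel by (intro emeasure_restrict_space) auto
  also have "\<dots> = emeasure lborel (ball 0 (1::real) :: (real^3) set)"
    by (rule emeasure_Diff_null_set) (auto intro: countable_imp_null_set_lborel)
  also have "\<dots> = ennreal (4/3 * pi)"
    by (subst emeasure_ball) (auto simp: unit_ball_vol_numeral DIM_cart fact_numeral field_simps power3_eq_cube)
  finally show ?thesis
    by (simp add: sphere_measure_def emeasure_scale_measure flip: ennreal_numeral ennreal_mult')
qed

text \<open>The hard-sphere scattering kernel. The integral of \<open>\<sigma>0 \<circ> \<theta>\<close> over the sphere does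
  not depend on the pair \<open>p \<noteq> q\<close> defining \<open>\<theta>\<close>.\<close>

definition hard_sphere_kernel ::
  "(real \<Rightarrow> real \<Rightarrow> real) \<Rightarrow> (real \<Rightarrow> real) \<Rightarrow> real \<Rightarrow> bool" where
  "hard_sphere_kernel \<sigma> \<sigma>0 c0 \<longleftrightarrow>
     (\<lambda>(g, \<theta>). \<sigma> g \<theta>) \<in> borel_measurable (lebesgue_on ({0..} \<times> {0..pi})) \<and>
     (\<forall>g\<ge>0. \<forall>\<theta>\<in>{0..pi}. 0 \<le> \<sigma> g \<theta>) \<and>
     \<sigma>0 \<in> borel_measurable (lebesgue_on {0..pi}) \<and>
     (\<forall>\<theta>\<in>{0..pi}. 0 \<le> \<sigma>0 \<theta> \<and> \<sigma>0 \<theta> \<le> 1 / (4 * pi)) \<and>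
     (\<exists>c1>0. \<exists>c2>0. \<forall>g\<ge>0. \<forall>\<theta>\<in>{0..pi}.
        c1 * (g * \<sigma>0 \<theta>) \<le> \<sigma> g \<theta> \<and> \<sigma> g \<theta> \<le> c2 * (g * \<sigma>0 \<theta>)) \<and>
     0 \<le> c0 \<and> c0 \<le> 1 \<and>
     (\<forall>p q. p \<noteq> q \<longrightarrow>
        (\<integral>\<^sup>+\<omega>. ennreal (\<sigma>0 (scattering_angle p q \<omega>)) \<partial>sphere_measure) = ennreal c0)"

text \<open>The gain operator for non-negative \<open>f\<close> and \<open>h\<close>; its value may be infinite.\<close>

definition gain ::
  "(real \<Rightarrow> real \<Rightarrow> real) \<Rightarrow> (real \<Rightarrow> real ^ 3 \<Rightarrow> real) \<Rightarrow> (real \<Rightarrow> real ^ 3 \<Rightarrow> real)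
   \<Rightarrow> real \<Rightarrow> real ^ 3 \<Rightarrow> ennreal" where
  "gain \<sigma> f h x p =
     (\<integral>\<^sup>+q. (\<integral>\<^sup>+\<omega>. ennreal (moller_velocity p q
        * \<sigma> (rel_momentum p q) (scattering_angle p q \<omega>)
        * f x (post_p p q \<omega>) * h x (post_q p q \<omega>)) \<partial>sphere_measure) \<partial>lebesgue)"

text \<open>The essential supremum over \<open>[0,1]\<close> of a non-negative function. On measurable functions
  it is the library's \<open>esssup\<close>, which however is \<open>\<top>\<close> by convention on non-measurable ones.\<close>

definition Linf_norm :: "(real \<Rightarrow> ennreal) \<Rightarrow> ennreal" where
  "Linf_norm u = Inf {c. AE x in lebesgue_on {0..1}. u x \<le> c}"

lemma Linf_norm_eq_esssup:
  "u \<in> borel_measurable (lebesgue_on {0..1}) \<Longrightarrow> Linf_norm u = esssup (lebesgue_on {0..1}) u"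
  by (simp add: Linf_norm_def esssup_eq_AE)

definition weight :: "real \<Rightarrow> real ^ 3 \<Rightarrow> real" where
  "weight k p = exp (k * energy p)"

definition weighted_norm :: "real \<Rightarrow> (real \<Rightarrow> real ^ 3 \<Rightarrow> real) \<Rightarrow> ennreal" where
  "weighted_norm k f =
     (\<integral>\<^sup>+p. ennreal (sqrt (energy p) * weight k p)
        * Linf_norm (\<lambda>x. ennreal \<bar>f x p\<bar>) \<partial>lebesgue)"

end

theory Submission
  imports Defs
begin

text \<open>The idea is the pre-post collisional change of variables. Parametrise a pair of momenta by its
  total momentum \<open>P = p + q\<close> and the momentum \<open>y\<close> of the first particle in the centre-of-momentum
  frame, so that \<open>|y| = g / 2\<close>. A collision fixes \<open>P\<close> and replaces \<open>y\<close> by \<open>|y| \<omega>\<close>, and the Jacobian of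
  the parametrisation times the Moller velocity depends on \<open>P\<close> and \<open>|y|\<close> only. In polar coordinates
  for \<open>y\<close> the measure \<open>v d\<omega> dq dp\<close> is thus symmetric under exchanging \<open>(p, q)\<close> and \<open>(p', q')\<close>. Since
  \<open>\<sigma> \<le> C g\<close> and \<open>\<phi>(p') \<le> \<phi>(p) \<phi>(q)\<close> by conservation of energy, it remains to bound
  \<open>v g \<integral> d\<omega> / |p' - a|\<close>. The map \<open>\<omega> \<mapsto> p'\<close> is \<open>g / 2\<close> times a stretching along
  \<open>P\<close> by a factor at least 1, so \<open>|p' - a| \<ge> (g / 2) |\<omega> - b|\<close> for some \<open>b\<close>, and \<open>\<integral> d\<omega> / |\<omega> - b|\<close> is bounded uniformly in \<open>b\<close>.\<close>

section \<open>Centre-of-momentum coordinates\<close>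

text \<open>The cancellation behind the symmetry is this: at fixed P, the determinant of y \<mapsto>
  (p - q) / 2 is p0 q0 / ((1 + |y|^2) \<gamma>), with \<gamma> the Lorentz factor of the pair, while
  the Moller velocity v has p0 q0 in its denominator. Exchanging the pairs moves the singular weight
  from p to p', where it can be averaged over \<omega> with the two factors f held fixed. That
  average is bounded only by a multiple of 1 / g, and the factor g of hard spheres is what removes
  this singularity; with v \<le> 4 the bound is uniform in P and a. The supremum over x is taken
  before any integration in momentum: f is dominated by a function F of the momentum alone. Since f
  is only Lebesgue measurable, F comes from a Borel representative, and domination off a null set
  has to survive the substitution of p' and q'.\<close>

text \<open>For p, q with centre-of-momentum momenta y and -y one has s = 4 (1 + |y|^2) and (p0 +
  q0)^2 = s + |P|^2, so this is \<open>lorentz_factor\<close> expressed through P and |y|; it is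
  called \<gamma> below.\<close>

definition boost_factor :: "real ^ 3 \<Rightarrow> real ^ 3 \<Rightarrow> real" where
  "boost_factor P y = sqrt (1 + (norm P)\<^sup>2 / (4 * (1 + (norm y)\<^sup>2)))"

text \<open>The lab-frame value of \<open>(p - q) / 2\<close> for a pair with total momentum \<open>P\<close> whose first particle
  has momentum \<open>y\<close> in the centre-of-momentum frame. For \<open>P = 0\<close> the division by zero gives \<open>y\<close>, as it
  should.\<close>

definition cm_boost :: "real ^ 3 \<Rightarrow> real ^ 3 \<Rightarrow> real ^ 3" where
  "cm_boost P y = y + ((boost_factor P y - 1) * ((P \<bullet> y) / (norm P)\<^sup>2)) *\<^sub>R P"

lemma boost_factor_sq: "(boost_factor P y)\<^sup>2 = 1 + (norm P)\<^sup>2 / (4 * (1 + (norm y)\<^sup>2))"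
  unfolding boost_factor_def by (rule real_sqrt_pow2) (auto intro!: add_nonneg_nonneg divide_nonneg_nonneg)

lemma boost_factor_ge_1: "1 \<le> boost_factor P y"
  unfolding boost_factor_def by (auto intro!: divide_nonneg_nonneg)

lemma boost_factor_cong: "norm y = norm z \<Longrightarrow> boost_factor P y = boost_factor P z"
  by (simp add: boost_factor_def)

lemma cm_boost_minus: "cm_boost P (- y) = - cm_boost P y"
  by (simp add: cm_boost_def boost_factor_def)

lemma inner_cm_boost: "P \<bullet> cm_boost P y = boost_factor P y * (P \<bullet> y)"
  by (cases "P = 0") (auto simp: cm_boost_def inner_simps field_simps power2_norm_eq_inner)

text \<open>Equal norms mean that both vectors are stretched by the same \<gamma>, and \<gamma>^2 -
  1 = |P|^2 / (4 (1 + |y|^2)) cancels the division by |P|^2. The polarised form serves the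
  scattering angle, which compares y with another vector of the same norm.\<close>

lemma cm_boost_inner_cm_boost:
  assumes "norm y = norm z"
  shows "cm_boost P y \<bullet> cm_boost P z = y \<bullet> z + (P \<bullet> y) * (P \<bullet> z) / (4 * (1 + (norm y)\<^sup>2))"
proof (cases "P = 0")
  case False
  define G where "G = boost_factor P y"
  have G: "boost_factor P z = G"
    using assms by (simp add: G_def boost_factor_def)
  have nz: "P \<bullet> P \<noteq> 0" using False by simp
  have y: "1 + y \<bullet> y > 0" by (simp add: add_pos_nonneg)
  have G2: "G\<^sup>2 = 1 + (P \<bullet> P) / (4 * (1 + y \<bullet> y))"
    unfolding G_def boost_factor_sq by (simp add: power2_norm_eq_inner)
  have "cm_boost P y \<bullet> cm_boost P z = y \<bullet> z + (G\<^sup>2 - 1) * ((P \<bullet> y) * (P \<bullet> z) / (P \<bullet> P))"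
    unfolding cm_boost_def G G_def[symmetric] power2_norm_eq_inner
    using nz by (simp add: inner_simps inner_commute field_simps power2_eq_square)
  also have "(G\<^sup>2 - 1) * ((P \<bullet> y) * (P \<bullet> z) / (P \<bullet> P)) = (P \<bullet> y) * (P \<bullet> z) / (4 * (1 + y \<bullet> y))"
    unfolding G2 using nz y by (simp add: field_simps)
  finally show ?thesis by (simp add: power2_norm_eq_inner)
qed (simp add: cm_boost_def)

lemma norm_cm_boost_sq: "(norm (cm_boost P y))\<^sup>2 = (norm y)\<^sup>2 + (P \<bullet> y)\<^sup>2 / (4 * (1 + (norm y)\<^sup>2))"
  using cm_boost_inner_cm_boost[of y y P] by (simp add: dot_square_norm flip: power2_eq_square)

text \<open>The two sides are half the energy difference (in absolute value) and half the total
  energy of the pair. The inequality makes both energies non-negative, so that a square root can be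
  extracted in \<open>energy_cm_boost\<close>.\<close>

lemma abs_inner_le_half_energy:
  "\<bar>P \<bullet> y\<bar> / (2 * sqrt (1 + (norm y)\<^sup>2)) \<le> sqrt (1 + (norm y)\<^sup>2) * boost_factor P y"
proof -
  define e where "e = sqrt (1 + (norm y)\<^sup>2)"
  have e: "e > 0" "e\<^sup>2 = 1 + (norm y)\<^sup>2" by (auto simp: e_def add_pos_nonneg)
  have ny: "norm y \<le> e"
    unfolding e_def by (rule real_le_rsqrt) simp
  have ge: "norm P / 2 \<le> e * boost_factor P y"
  proof (rule power2_le_imp_le)
    show "(norm P / 2)\<^sup>2 \<le> (e * boost_factor P y)\<^sup>2"
      using e by (simp add: power_mult_distrib boost_factor_sq flip: e(2)) (simp add: field_simps power2_eq_square)
    show "0 \<le> e * boost_factor P y" using e boost_factor_ge_1[of P y] by auto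
  qed
  have "\<bar>P \<bullet> y\<bar> \<le> norm P * e"
    using Cauchy_Schwarz_ineq2[of P y] mult_left_mono[OF ny, of "norm P"] by simp
  then have "\<bar>P \<bullet> y\<bar> / (2 * e) \<le> norm P / 2" using e by (simp add: field_simps)
  then show ?thesis using ge by (simp add: e_def)
qed

text \<open>This is the Lorentz transformation of the energy e = sqrt (1 + |y|^2), with \<gamma>
  times the boost velocity equal to P / (2 e). The computation shows that 1 + |p|^2 is a perfect
  square.\<close>

lemma energy_cm_boost:
  "energy ((1/2) *\<^sub>R P + cm_boost P y) =
     sqrt (1 + (norm y)\<^sup>2) * boost_factor P y + (P \<bullet> y) / (2 * sqrt (1 + (norm y)\<^sup>2))"
proof -
  define e where "e = sqrt (1 + (norm y)\<^sup>2)"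
  have e: "e > 0" "1 + (norm y)\<^sup>2 = e\<^sup>2" by (auto simp: e_def add_pos_nonneg)
  define G where "G = boost_factor P y"
  have G: "G\<^sup>2 = 1 + (norm P)\<^sup>2 / (4 * e\<^sup>2)"
    unfolding G_def boost_factor_sq e(2) ..
  have "(norm ((1/2) *\<^sub>R P + cm_boost P y))\<^sup>2 =
      (norm P)\<^sup>2 / 4 + P \<bullet> cm_boost P y + (norm (cm_boost P y))\<^sup>2"
    by (simp add: power2_norm_eq_inner inner_simps inner_commute field_simps)
  also have "\<dots> = (norm P)\<^sup>2 / 4 + G * (P \<bullet> y) + (e\<^sup>2 - 1) + (P \<bullet> y)\<^sup>2 / (4 * e\<^sup>2)"
    by (simp add: inner_cm_boost norm_cm_boost_sq G_def flip: e(2))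
  also have "\<dots> = (e * G + (P \<bullet> y) / (2 * e))\<^sup>2 - 1"
    using e(1) unfolding power2_sum power_mult_distrib G by (simp add: field_simps power2_eq_square)
  finally have *: "1 + (norm ((1/2) *\<^sub>R P + cm_boost P y))\<^sup>2 = (e * G + (P \<bullet> y) / (2 * e))\<^sup>2"
    by simp
  have "0 \<le> e * G + (P \<bullet> y) / (2 * e)"
    using abs_inner_le_half_energy[of P y] abs_ge_minus_self[of "(P \<bullet> y) / (2 * e)"] e(1)
    unfolding e_def[symmetric] G_def[symmetric] by simp
  then show ?thesis
    unfolding energy_def * by (simp add: e_def G_def)
qed

lemma energy_cm_boost':
  "energy ((1/2) *\<^sub>R P - cm_boost P y) =
     sqrt (1 + (norm y)\<^sup>2) * boost_factor P y - (P \<bullet> y) / (2 * sqrt (1 + (norm y)\<^sup>2))"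
  using energy_cm_boost[of P "- y"] by (simp add: cm_boost_minus boost_factor_def)

text \<open>Lorentz invariance of g: the energy difference is (P . y) / e, and its square is exactly
  the excess of 4 |\<open>cm_boost P y\<close>|^2 over 4 |y|^2.\<close>

lemma rel_momentum_cm_boost:
  "rel_momentum ((1/2) *\<^sub>R P + cm_boost P y) ((1/2) *\<^sub>R P - cm_boost P y) = 2 * norm y"
proof -
  define e where "e = sqrt (1 + (norm y)\<^sup>2)"
  have e: "e > 0" "1 + (norm y)\<^sup>2 = e\<^sup>2" by (auto simp: e_def add_pos_nonneg)
  have "(1/2) *\<^sub>R P + cm_boost P y - ((1/2) *\<^sub>R P - cm_boost P y) = 2 *\<^sub>R cm_boost P y"
    by (simp add: scaleR_2)
  then have "rel_momentum ((1/2) *\<^sub>R P + cm_boost P y) ((1/2) *\<^sub>R P - cm_boost P y) =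
     sqrt (4 * (norm (cm_boost P y))\<^sup>2 - ((P \<bullet> y) / e)\<^sup>2)"
    unfolding rel_momentum_def energy_cm_boost energy_cm_boost'
    by (simp add: power_mult_distrib flip: e_def)
  also have "4 * (norm (cm_boost P y))\<^sup>2 - ((P \<bullet> y) / e)\<^sup>2 = (2 * norm y)\<^sup>2"
    unfolding norm_cm_boost_sq e using e by (simp add: field_simps)
  finally show ?thesis by (simp add: real_sqrt_mult)
qed

lemma energy_ge_1: "1 \<le> energy p"
  by (simp add: energy_def)

text \<open>The energy is the Euclidean norm of (1, p), hence 1-Lipschitz in p. This makes the
  radicand of \<open>rel_momentum\<close> non-negative.\<close>

lemma energy_diff_le: "(energy p - energy q)\<^sup>2 \<le> (norm (p - q))\<^sup>2"
proof -
  have *: "energy x = norm (1 :: real, x)" for x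
    by (simp add: energy_def norm_Pair)
  have "\<bar>energy p - energy q\<bar> \<le> norm ((1 :: real, p) - (1, q))"
    unfolding * by (rule norm_triangle_ineq3)
  then have "\<bar>energy p - energy q\<bar> \<le> norm (p - q)" by simp
  then show ?thesis by (metis abs_le_square_iff abs_norm_cancel)
qed

lemma rel_momentum_sq: "(rel_momentum p q)\<^sup>2 = (norm (p - q))\<^sup>2 - (energy p - energy q)\<^sup>2"
  unfolding rel_momentum_def using energy_diff_le by simp

lemma energy_sq: "(energy p)\<^sup>2 = 1 + (norm p)\<^sup>2"
  by (simp add: energy_def)

lemma energy_sum_sq: "(energy p + energy q)\<^sup>2 = (rel_momentum p q)\<^sup>2 + 4 + (norm (p + q))\<^sup>2"
proof -
  have "(norm (p - q))\<^sup>2 + (norm (p + q))\<^sup>2 = 2 * (norm p)\<^sup>2 + 2 * (norm q)\<^sup>2"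
    by (simp add: power2_norm_eq_inner inner_simps inner_commute)
  then show ?thesis
    unfolding rel_momentum_sq power2_sum power2_diff using energy_sq[of p] energy_sq[of q] by simp
qed

section \<open>Bijectivity of the boost at fixed total momentum\<close>

text \<open>The only nonlinearity is that \<gamma> depends on |y|, and |y| is half the relative
  momentum of the pair. Once |y| is recovered, a linear stretching along P by \<gamma> \<ge> 1
  remains.\<close>

lemma inj_cm_boost: "inj (cm_boost P)"
proof (rule injI)
  fix y z assume eq: "cm_boost P y = cm_boost P z"
  have "norm y = norm z"
    using rel_momentum_cm_boost[of P y] rel_momentum_cm_boost[of P z] eq by simp
  then have G: "boost_factor P y = boost_factor P z" by (rule boost_factor_cong)
  then have "P \<bullet> y = P \<bullet> z"
    using inner_cm_boost[of P y] inner_cm_boost[of P z] eq boost_factor_ge_1[of P z] by simp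
  then show "y = z" using eq G by (simp add: cm_boost_def)
qed

text \<open>The preimage is explicit: its norm must be r = g / 2, so r determines \<gamma>, and
  undoing the stretching compresses d along P by 1 / \<gamma>. The point to check is the consistency
  |y| = r.\<close>

lemma surj_cm_boost: "surj (cm_boost P)"
proof -
  have "\<exists>y. cm_boost P y = d" for d
  proof -
  define p q where "p = (1/2) *\<^sub>R P + d" and "q = (1/2) *\<^sub>R P - d"
  define r where "r = rel_momentum p q / 2"
  define E where "E = energy p + energy q"
  define G where "G = sqrt (1 + (norm P)\<^sup>2 / (4 * (1 + r\<^sup>2)))"
  define y where "y = d - ((1 - 1 / G) * ((P \<bullet> d) / (norm P)\<^sup>2)) *\<^sub>R P"
  have pq: "p + q = P" "p - q = 2 *\<^sub>R d"
    by (simp_all add: p_def q_def algebra_simps scaleR_2 flip: scaleR_add_left)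
  have E2: "E\<^sup>2 = 4 * (1 + r\<^sup>2) + (norm P)\<^sup>2"
    unfolding E_def energy_sum_sq pq r_def by (simp add: power_divide)
  have s: "1 + r\<^sup>2 > 0" by (simp add: add_pos_nonneg)
  have G2: "G\<^sup>2 = 1 + (norm P)\<^sup>2 / (4 * (1 + r\<^sup>2))"
    unfolding G_def using s by (intro real_sqrt_pow2) (auto intro!: add_nonneg_nonneg divide_nonneg_nonneg)
  have G1: "G \<ge> 1" unfolding G_def using s by auto
  have E2': "E\<^sup>2 = 4 * (1 + r\<^sup>2) * G\<^sup>2" unfolding E2 G2 using s by (simp add: field_simps)
  have E0: "E > 0" using energy_ge_1[of p] energy_ge_1[of q] by (simp add: E_def)
  \<comment> \<open>The energy difference comes from the difference of the squared energies, which
    is linear in d.\<close>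
  have "(energy p - energy q) * E = (energy p)\<^sup>2 - (energy q)\<^sup>2"
    by (simp add: E_def power2_eq_square algebra_simps)
  also have "\<dots> = 2 * (P \<bullet> d)"
    unfolding energy_sq p_def q_def by (simp add: power2_norm_eq_inner inner_simps inner_commute)
  finally have ediff: "energy p - energy q = 2 * (P \<bullet> d) / E" using E0 by (simp add: field_simps)
  have r2: "r\<^sup>2 = (norm d)\<^sup>2 - (P \<bullet> d)\<^sup>2 / E\<^sup>2"
    unfolding r_def power_divide rel_momentum_sq pq ediff by (simp add: power_mult_distrib power_divide)
  have y2: "(norm y)\<^sup>2 = r\<^sup>2"
  proof (cases "P = 0")
    case True then show ?thesis using r2 by (simp add: y_def)
  next
    case False
    then have nz: "P \<bullet> P \<noteq> 0" by simp
    have "(norm y)\<^sup>2 = (norm d)\<^sup>2 - (1 - 1 / G\<^sup>2) * ((P \<bullet> d)\<^sup>2 / (norm P)\<^sup>2)"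
      using nz G1 by (simp add: y_def power2_norm_eq_inner inner_simps inner_commute)
        (simp add: field_simps power2_eq_square)
    also have "1 - 1 / G\<^sup>2 = (G\<^sup>2 - 1) / G\<^sup>2" using G1 by (simp add: field_simps)
    also have "\<dots> = (norm P)\<^sup>2 / E\<^sup>2"
      unfolding E2' using s G1 by (simp add: G2 field_simps)
    finally show ?thesis using r2 False by simp
  qed
  then have Gy: "boost_factor P y = G" by (simp add: boost_factor_def G_def)
  have Py: "P \<bullet> y = (P \<bullet> d) / G"
    using G1 by (cases "P = 0") (simp_all add: y_def inner_simps power2_norm_eq_inner field_simps)
  have coef: "(G - 1) * ((P \<bullet> d) / G / (norm P)\<^sup>2) = (1 - 1 / G) * ((P \<bullet> d) / (norm P)\<^sup>2)"
    using G1 by (cases "P = 0") (simp_all add: field_simps)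
  have "cm_boost P y = d"
    unfolding cm_boost_def Gy Py coef by (simp add: y_def)
  then show ?thesis by blast
  qed
  then show ?thesis unfolding surj_def by metis
qed

section \<open>Collisions in centre-of-momentum coordinates\<close>

text \<open>The Lorentz factor in the collision formula is \<open>boost_factor P y\<close>, and it
  does not change when y is replaced by |y| \<omega>. Hence \<open>collision_dir\<close> times g / 2
  is again a boosted vector.\<close>

lemma post_cm_boost:
  assumes "norm \<omega> = 1"
  shows "post_p ((1/2) *\<^sub>R P + cm_boost P y) ((1/2) *\<^sub>R P - cm_boost P y) \<omega> =
           (1/2) *\<^sub>R P + cm_boost P (norm y *\<^sub>R \<omega>)" (is "post_p ?p ?q \<omega> = _")
    and "post_q ((1/2) *\<^sub>R P + cm_boost P y) ((1/2) *\<^sub>R P - cm_boost P y) \<omega> =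
           (1/2) *\<^sub>R P - cm_boost P (norm y *\<^sub>R \<omega>)"
proof -
  define e where "e = sqrt (1 + (norm y)\<^sup>2)"
  have e: "e > 0" "1 + (norm y)\<^sup>2 = e\<^sup>2" by (auto simp: e_def add_pos_nonneg)
  have sum: "?p + ?q = P"
    by (simp add: algebra_simps flip: scaleR_add_left)
  have "cm_energy_sq ?p ?q = (2 * e)\<^sup>2"
    unfolding cm_energy_sq_def rel_momentum_cm_boost using e(2) by (simp add: power_mult_distrib)
  moreover have "energy ?p + energy ?q = 2 * e * boost_factor P y"
    unfolding energy_cm_boost energy_cm_boost' by (simp add: e_def)
  ultimately have G: "lorentz_factor ?p ?q = boost_factor P y"
    unfolding lorentz_factor_def using e(1) by (simp add: real_sqrt_mult)
  have G': "boost_factor P (norm y *\<^sub>R \<omega>) = boost_factor P y"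
    by (rule boost_factor_cong) (simp add: assms)
  have *: "(rel_momentum ?p ?q / 2) *\<^sub>R collision_dir ?p ?q \<omega> = cm_boost P (norm y *\<^sub>R \<omega>)"
    unfolding rel_momentum_cm_boost collision_dir_def G sum cm_boost_def[of P "norm y *\<^sub>R \<omega>"] G'
    by (simp add: scaleR_add_right mult_ac)
  show "post_p ?p ?q \<omega> = (1/2) *\<^sub>R P + cm_boost P (norm y *\<^sub>R \<omega>)"
       "post_q ?p ?q \<omega> = (1/2) *\<^sub>R P - cm_boost P (norm y *\<^sub>R \<omega>)"
    unfolding post_p_def post_q_def * sum by simp_all
qed

lemma cm_coordinates:
  obtains P y where "p = (1/2) *\<^sub>R P + cm_boost P y" "q = (1/2) *\<^sub>R P - cm_boost P y"
proof -
  obtain y where y: "cm_boost (p + q) y = (1/2) *\<^sub>R (p - q)"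
    using surj_cm_boost[of "p + q"] by (metis surjD)
  show thesis
    by (rule that[of "p + q" y]; simp add: y algebra_simps flip: scaleR_add_left)
qed

text \<open>The Minkowski product of the momentum differences before and after the collision is 4 (y
  . z) with z = |y| \<omega>, so \<theta> is the angle between y and \<omega>.\<close>

lemma scattering_angle_cm_boost:
  assumes "norm \<omega> = 1" "y \<noteq> 0"
  shows "scattering_angle ((1/2) *\<^sub>R P + cm_boost P y) ((1/2) *\<^sub>R P - cm_boost P y) \<omega> =
           arccos ((y \<bullet> \<omega>) / norm y)"
proof -
  define z where "z = norm y *\<^sub>R \<omega>"
  have nz: "norm z = norm y" by (simp add: z_def assms)
  define e where "e = sqrt (1 + (norm y)\<^sup>2)"
  have e: "e > 0" "1 + (norm y)\<^sup>2 = e\<^sup>2" by (auto simp: e_def add_pos_nonneg)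
  have diff: "(1/2) *\<^sub>R P + d - ((1/2) *\<^sub>R P - d) = 2 *\<^sub>R d" for d :: "real ^ 3"
    by (simp add: scaleR_2)
  have ediff: "energy ((1/2) *\<^sub>R P + cm_boost P x) - energy ((1/2) *\<^sub>R P - cm_boost P x) = (P \<bullet> x) / e"
    if "norm x = norm y" for x
    unfolding energy_cm_boost energy_cm_boost' that by (simp add: e_def)
  have "- ((P \<bullet> y) / e) * ((P \<bullet> z) / e) + (2 *\<^sub>R cm_boost P y) \<bullet> (2 *\<^sub>R cm_boost P z) =
      4 * (y \<bullet> z)"
    using e nz by (simp add: cm_boost_inner_cm_boost power2_eq_square)
  then show ?thesis
    unfolding scattering_angle_def post_cm_boost[OF assms(1)] z_def[symmetric]
      ediff[OF refl] ediff[OF nz] diff rel_momentum_cm_boost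
    using assms by (simp add: z_def power2_eq_square)
qed

text \<open>\<open>arccos\<close> is controlled only on [-1, 1]. Cauchy-Schwarz in the
  centre-of-momentum frame puts its argument there, and \<theta> into the range where the kernel
  bounds are assumed.\<close>

lemma scattering_angle_bounds:
  assumes "norm \<omega> = 1" "p \<noteq> q"
  shows "scattering_angle p q \<omega> \<in> {0..pi}"
proof -
  obtain P y where pq: "p = (1/2) *\<^sub>R P + cm_boost P y" "q = (1/2) *\<^sub>R P - cm_boost P y"
    by (rule cm_coordinates)
  have "y \<noteq> 0" using assms(2) by (auto simp: pq cm_boost_def)
  moreover have "\<bar>y \<bullet> \<omega>\<bar> \<le> norm y" using Cauchy_Schwarz_ineq2[of y \<omega>] assms(1) by simp
  ultimately have "\<bar>(y \<bullet> \<omega>) / norm y\<bar> \<le> 1" by simp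
  then have "- 1 \<le> (y \<bullet> \<omega>) / norm y" "(y \<bullet> \<omega>) / norm y \<le> 1"
    unfolding abs_le_iff by linarith+
  then show ?thesis
    unfolding pq scattering_angle_cm_boost[OF assms(1) \<open>y \<noteq> 0\<close>]
    using arccos_lbound arccos_ubound by simp
qed

lemma energy_mult_cm_boost:
  "energy ((1/2) *\<^sub>R P + cm_boost P y) * energy ((1/2) *\<^sub>R P - cm_boost P y) =
     (1 + (norm y)\<^sup>2) * (boost_factor P y)\<^sup>2 - (P \<bullet> y)\<^sup>2 / (4 * (1 + (norm y)\<^sup>2))"
proof -
  define e where "e = sqrt (1 + (norm y)\<^sup>2)"
  have e: "e > 0" "1 + (norm y)\<^sup>2 = e\<^sup>2" by (auto simp: e_def add_pos_nonneg)
  show ?thesis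
    unfolding energy_cm_boost energy_cm_boost' e_def[symmetric] e(2)
    by (simp add: algebra_simps power2_eq_square)
qed

text \<open>By Cauchy-Schwarz the subtracted term of the product formula is at most |P|^2 / 4, which
  is exactly what \<gamma>^2 contributes beyond 1 + |y|^2.\<close>

lemma energy_mult_cm_boost_ge:
  "1 + (norm y)\<^sup>2 \<le> energy ((1/2) *\<^sub>R P + cm_boost P y) * energy ((1/2) *\<^sub>R P - cm_boost P y)"
proof -
  have s: "1 + (norm y)\<^sup>2 > 0" by (simp add: add_pos_nonneg)
  have "(P \<bullet> y)\<^sup>2 \<le> (norm P)\<^sup>2 * (norm y)\<^sup>2"
    using Cauchy_Schwarz_ineq[of P y] by (simp add: power2_norm_eq_inner)
  also have "\<dots> \<le> (norm P)\<^sup>2 * (1 + (norm y)\<^sup>2)" by (intro mult_left_mono) auto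
  finally have "(P \<bullet> y)\<^sup>2 / (4 * (1 + (norm y)\<^sup>2)) \<le> (norm P)\<^sup>2 / 4"
    using s by (simp add: field_simps)
  moreover have "(1 + (norm y)\<^sup>2) * (boost_factor P y)\<^sup>2 = 1 + (norm y)\<^sup>2 + (norm P)\<^sup>2 / 4"
    unfolding boost_factor_sq using s by (simp add: field_simps)
  ultimately show ?thesis unfolding energy_mult_cm_boost by simp
qed

lemma moller_velocity_cm_boost:
  "moller_velocity ((1/2) *\<^sub>R P + cm_boost P y) ((1/2) *\<^sub>R P - cm_boost P y) =
     4 * norm y * sqrt (1 + (norm y)\<^sup>2) /
     (energy ((1/2) *\<^sub>R P + cm_boost P y) * energy ((1/2) *\<^sub>R P - cm_boost P y))"
proof -
  have "sqrt (cm_energy_sq ((1/2) *\<^sub>R P + cm_boost P y) ((1/2) *\<^sub>R P - cm_boost P y)) =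
      sqrt (4 * (1 + (norm y)\<^sup>2))"
    by (simp add: cm_energy_sq_def rel_momentum_cm_boost power_mult_distrib)
  then show ?thesis
    unfolding moller_velocity_def rel_momentum_cm_boost real_sqrt_mult by simp
qed

lemma rel_momentum_nonneg: "0 \<le> rel_momentum p q"
  using energy_diff_le by (simp add: rel_momentum_def)

lemma moller_velocity_nonneg: "0 \<le> moller_velocity p q"
  unfolding moller_velocity_def using energy_ge_1[of p] energy_ge_1[of q] rel_momentum_nonneg[of p q]
  by (intro divide_nonneg_nonneg mult_nonneg_nonneg) (auto simp: cm_energy_sq_def)

text \<open>The numerator g sqrt s equals 4 |y| sqrt (1 + |y|^2), which is at most 4 (1 + |y|^2),
  and 1 + |y|^2 \<le> p0 q0.\<close>

lemma moller_velocity_le: "moller_velocity p q \<le> 4"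
proof -
  obtain P y where pq: "p = (1/2) *\<^sub>R P + cm_boost P y" "q = (1/2) *\<^sub>R P - cm_boost P y"
    by (rule cm_coordinates)
  have s: "1 + (norm y)\<^sup>2 > 0" by (simp add: add_pos_nonneg)
  have "norm y * sqrt (1 + (norm y)\<^sup>2) \<le> sqrt (1 + (norm y)\<^sup>2) * sqrt (1 + (norm y)\<^sup>2)"
    by (intro mult_right_mono real_le_rsqrt) auto
  also have "\<dots> = 1 + (norm y)\<^sup>2" using s by simp
  also have "\<dots> \<le> energy p * energy q" unfolding pq by (rule energy_mult_cm_boost_ge)
  finally have *: "norm y * sqrt (1 + (norm y)\<^sup>2) \<le> energy p * energy q" .
  have "energy p * energy q > 0" using energy_ge_1[of p] energy_ge_1[of q] by simp
  then show ?thesis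
    using * unfolding pq moller_velocity_cm_boost by (simp add: field_simps)
qed

lemma energy_conservation:
  assumes "norm \<omega> = 1"
  shows "energy (post_p p q \<omega>) + energy (post_q p q \<omega>) = energy p + energy q"
proof -
  obtain P y where pq: "p = (1/2) *\<^sub>R P + cm_boost P y" "q = (1/2) *\<^sub>R P - cm_boost P y"
    by (rule cm_coordinates)
  show ?thesis
    unfolding pq post_cm_boost[OF assms] energy_cm_boost energy_cm_boost'
    using assms by (simp add: boost_factor_def)
qed

text \<open>With \<gamma> frozen at y the map is linear in x, and on the sphere |x| = |y| it is
  \<open>cm_boost P\<close>. The added vector is a non-negative multiple of the projection of x onto
  P, so it cannot shorten x.\<close>

lemma norm_cm_boost_dir_ge:
  "norm x \<le> norm (x + ((boost_factor P y - 1) * ((P \<bullet> x) / (norm P)\<^sup>2)) *\<^sub>R P)"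
proof (cases "P = 0")
  case False
  define c where "c = (boost_factor P y - 1) / (norm P)\<^sup>2"
  have c: "c \<ge> 0" using boost_factor_ge_1[of P y] by (simp add: c_def)
  have "(norm (x + (c * (P \<bullet> x)) *\<^sub>R P))\<^sup>2 = (norm x)\<^sup>2 + 2 * c * (P \<bullet> x)\<^sup>2 + (c * (P \<bullet> x) * norm P)\<^sup>2"
    unfolding power_mult_distrib power2_norm_eq_inner
    by (simp add: inner_simps inner_commute algebra_simps power2_eq_square)
  also have "\<dots> \<ge> (norm x)\<^sup>2" using c by simp
  finally show ?thesis by (simp add: c_def)
qed simp

section \<open>The Jacobian of the boost\<close>

text \<open>The measure with density |det g'|, pushed forward by g, agrees with Lebesgue measure on
  boxes and therefore everywhere. Integrability is thus only a matter of box indicators, and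
  infinite integrals of f are covered.\<close>

lemma nn_integral_change_of_variables:
  fixes g :: "real ^ 'm::{finite,wellorder} \<Rightarrow> real ^ 'm::_"
  assumes der: "\<And>x. (g has_derivative g' x) (at x)"
    and bij: "bij g"
    and [measurable]: "(\<lambda>x. det (matrix (g' x))) \<in> borel_measurable borel"
    and [measurable]: "f \<in> borel_measurable borel"
  shows "(\<integral>\<^sup>+x. f x \<partial>lborel) = (\<integral>\<^sup>+x. ennreal \<bar>det (matrix (g' x))\<bar> * f (g x) \<partial>lborel)"
proof -
  have "continuous_on UNIV g"
    using der by (metis continuous_at_imp_continuous_on has_derivative_continuous)
  then have [measurable]: "g \<in> borel_measurable borel" by (rule borel_measurable_continuous_onI)
  define M where "M = distr (density lborel (\<lambda>x. ennreal \<bar>det (matrix (g' x))\<bar>)) borel g"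
  have "lborel = M"
  proof (rule lborel_eqI)
    show "sets M = sets borel" by (simp add: M_def)
    fix l u :: "real ^ 'm::{finite,wellorder}" assume lu: "\<And>b. b \<in> Basis \<Longrightarrow> l \<bullet> b \<le> u \<bullet> b"
    define c where "c = (\<Prod>b\<in>Basis. (u - l) \<bullet> b)"
    define h where "h = (\<lambda>x. indicator (box l u) x :: real)"
    have "(h has_integral c) UNIV"
      unfolding h_def
      by (rule has_integral_iff_nn_integral_lebesgue[THEN iffD2])
        (auto simp: nn_integral_completion ennreal_indicator emeasure_lborel_box[OF lu] c_def inner_diff_left
           intro!: prod_nonneg lu borel_measurable_indicator)
    \<comment> \<open>The change of variables for absolutely integrable functions takes vector
      values; \<open>vec\<close> places the indicator in \<open>real ^ 1\<close>.\<close>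
    then have "(\<lambda>x. vec (h x) :: real ^ 1) absolutely_integrable_on range g \<and>
        integral (range g) (\<lambda>x. vec (h x) :: real ^ 1) = vec c"
      using bij_is_surj[OF bij]
      by (auto simp: absolutely_integrable_on_1_iff integral_on_1_eq h_def has_integral_iff
            intro!: nonnegative_absolutely_integrable_1)
    then have "(\<lambda>x. \<bar>det (matrix (g' x))\<bar> *\<^sub>R (vec (h (g x)) :: real ^ 1)) absolutely_integrable_on UNIV \<and>
        integral UNIV (\<lambda>x. \<bar>det (matrix (g' x))\<bar> *\<^sub>R (vec (h (g x)) :: real ^ 1)) = vec c"
      by (subst has_absolute_integral_change_of_variables)
         (use der bij in \<open>auto simp: bij_is_inj\<close>)
    then have "((\<lambda>x. \<bar>det (matrix (g' x))\<bar> * h (g x)) has_integral c) UNIV"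
      by (auto simp: absolutely_integrable_on_1_iff integral_on_1_eq has_integral_iff vec_eq_iff
          absolutely_integrable_on_def)
    from nn_integral_has_integral_lebesgue'[OF _ this]
    have "(\<integral>\<^sup>+x. ennreal (\<bar>det (matrix (g' x))\<bar> * h (g x)) \<partial>lborel) = ennreal c"
      by (simp add: h_def)
    also have "(\<integral>\<^sup>+x. ennreal (\<bar>det (matrix (g' x))\<bar> * h (g x)) \<partial>lborel) = emeasure M (box l u)"
    proof -
      have [measurable]: "g -` box l u \<in> sets borel"
        by (rule measurable_sets_borel[OF _ borel_open]) (auto simp: open_box)
      show ?thesis
        unfolding M_def
        by (simp add: emeasure_distr emeasure_density)
          (auto intro!: nn_integral_cong simp: h_def indicator_def)
    qed
    finally show "emeasure M (box l u) = ennreal (\<Prod>b\<in>Basis. (u - l) \<bullet> b)"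
      by (simp add: c_def)
  qed
  then have "(\<integral>\<^sup>+x. f x \<partial>lborel) = (\<integral>\<^sup>+x. f x \<partial>M)" by simp
  also have "\<dots> = (\<integral>\<^sup>+x. ennreal \<bar>det (matrix (g' x))\<bar> * f (g x) \<partial>lborel)"
    unfolding M_def by (subst nn_integral_distr; simp add: nn_integral_density)
  finally show ?thesis .
qed

lemma det_matrix_rank_one_update:
  fixes P w :: "real ^ 3"
  shows "det (matrix (\<lambda>h. h + (w \<bullet> h) *\<^sub>R P)) = 1 + w \<bullet> P"
  by (simp add: det_3 matrix_def inner_vec_def sum_3 axis_def) (simp add: algebra_simps)

text \<open>The gradient in y of the coefficient of \<open>P\<close> in \<open>cm_boost P y\<close>.
  The second term comes from the dependence of \<gamma> on |y|, with |P|^2 already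
  cancelled.\<close>

definition boost_gradient :: "real ^ 3 \<Rightarrow> real ^ 3 \<Rightarrow> real ^ 3" where
  "boost_gradient P y = ((boost_factor P y - 1) / (norm P)\<^sup>2) *\<^sub>R P
     - ((P \<bullet> y) / (4 * (1 + (norm y)\<^sup>2)\<^sup>2 * boost_factor P y)) *\<^sub>R y"

lemma has_derivative_boost_factor:
  "(boost_factor P has_derivative
     (\<lambda>h. - ((norm P)\<^sup>2 / (4 * (1 + (norm y)\<^sup>2)\<^sup>2 * boost_factor P y) * (y \<bullet> h)))) (at y)"
proof -
  define s where "s = 1 + y \<bullet> y"
  have s: "s > 0" by (simp add: s_def add_pos_nonneg)
  define c where "c = (norm P)\<^sup>2"
  have pos: "0 < 1 + c / (4 * s)" using s by (simp add: c_def add_pos_nonneg)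
  have G: "boost_factor P y = sqrt (1 + c / (4 * s))"
    by (simp add: boost_factor_def c_def s_def power2_norm_eq_inner)
  \<comment> \<open>The chain rule goes through t = y . y, because |y| is not differentiable at
    0.\<close>
  have "((\<lambda>t. 1 + c / (4 * (1 + t))) has_real_derivative - (c * 4 / (4 * s * (4 * s)))) (at (y \<bullet> y))"
    using s unfolding s_def by (auto intro!: derivative_eq_intros)
  also have "c * 4 / (4 * s * (4 * s)) = c / (4 * s\<^sup>2)"
    by (simp add: power2_eq_square)
  finally have "((\<lambda>t. 1 + c / (4 * (1 + t))) has_real_derivative - (c / (4 * s\<^sup>2))) (at (y \<bullet> y))" .
  from DERIV_chain2[OF DERIV_real_sqrt this] pos
  have "((\<lambda>t. sqrt (1 + c / (4 * (1 + t)))) has_real_derivative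
     - (c / (8 * s\<^sup>2 * sqrt (1 + c / (4 * s))))) (at (y \<bullet> y))"
    by (simp add: s_def field_simps)
  moreover have "((\<lambda>y. y \<bullet> y) has_derivative (\<lambda>h. 2 * (y \<bullet> h))) (at y)"
    by (auto intro!: derivative_eq_intros simp: inner_commute)
  ultimately have "((\<lambda>y. sqrt (1 + c / (4 * (1 + y \<bullet> y)))) has_derivative
     (\<lambda>h. 2 * (y \<bullet> h) * - (c / (8 * s\<^sup>2 * sqrt (1 + c / (4 * s)))))) (at y)"
    by (rule DERIV_compose_FDERIV)
  then show ?thesis
    unfolding boost_factor_def[abs_def] c_def s_def power2_norm_eq_inner
    by (simp add: mult_ac)
qed

lemma has_derivative_cm_boost:
  "(cm_boost P has_derivative (\<lambda>h. h + (boost_gradient P y \<bullet> h) *\<^sub>R P)) (at y)"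
proof (cases "P = 0")
  case True
  then show ?thesis by (simp add: cm_boost_def[abs_def] )
next
  case False
  define k where "k = 1 / (norm P)\<^sup>2"
  define D where "D = (norm P)\<^sup>2 / (4 * (1 + (norm y)\<^sup>2)\<^sup>2 * boost_factor P y)"
  have D: "D * k = 1 / (4 * (1 + (norm y)\<^sup>2)\<^sup>2 * boost_factor P y)"
    using False by (simp add: D_def k_def)
  have [derivative_intros]: "((\<lambda>y. P \<bullet> y) has_derivative (\<lambda>h. P \<bullet> h)) (at y)"
    by (rule bounded_linear_imp_has_derivative) (rule bounded_linear_inner_right)
  have "((\<lambda>y. y + ((boost_factor P y - 1) * ((P \<bullet> y) * k)) *\<^sub>R P) has_derivative
      (\<lambda>h. h + ((boost_factor P y - 1) * ((P \<bullet> h) * k) + (- (D * (y \<bullet> h)) - 0) * ((P \<bullet> y) * k)) *\<^sub>R P)) (at y)"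
    unfolding D_def
    by (intro has_derivative_add has_derivative_ident has_derivative_scaleR_left has_derivative_mult
        has_derivative_diff has_derivative_boost_factor has_derivative_const has_derivative_mult_left derivative_intros)
  moreover have "(boost_factor P y - 1) * ((P \<bullet> h) * k) + (- (D * (y \<bullet> h)) - 0) * ((P \<bullet> y) * k) =
      boost_gradient P y \<bullet> h" for h
  proof -
    have "(- (D * (y \<bullet> h)) - 0) * ((P \<bullet> y) * k) = - ((P \<bullet> y) * (D * k) * (y \<bullet> h))" by simp
    then show ?thesis
      unfolding D boost_gradient_def by (simp add: inner_diff_left k_def)
  qed
  ultimately show ?thesis
    unfolding cm_boost_def[abs_def] k_def by simp
qed

text \<open>The rank-one formula gives \<gamma> - (P . y)^2 / (4 (1 + |y|^2)^2 \<gamma>), which is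
  the product formula for p0 q0 divided by (1 + |y|^2) \<gamma>.\<close>

lemma det_cm_boost:
  "det (matrix (\<lambda>h. h + (boost_gradient P y \<bullet> h) *\<^sub>R P)) =
     energy ((1/2) *\<^sub>R P + cm_boost P y) * energy ((1/2) *\<^sub>R P - cm_boost P y)
       / ((1 + (norm y)\<^sup>2) * boost_factor P y)"
proof -
  define s where "s = 1 + (norm y)\<^sup>2"
  have s: "s > 0" by (simp add: s_def add_pos_nonneg)
  define G where "G = boost_factor P y"
  have G: "G > 0" using boost_factor_ge_1[of P y] by (simp add: G_def)
  \<comment> \<open>For P = 0 the division by zero makes the gradient 0, in agreement with \<gamma>
    - 1 = 0.\<close>
  have "P \<bullet> P = 0 \<Longrightarrow> G = 1" by (simp add: G_def boost_factor_def)
  then have "boost_gradient P y \<bullet> P = G - 1 - (P \<bullet> y)\<^sup>2 / (4 * s\<^sup>2 * G)"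
    unfolding boost_gradient_def G_def[symmetric] s_def[symmetric]
    by (cases "P = 0") (simp_all add: inner_diff_left dot_square_norm inner_commute[of y P] power2_eq_square[of "P \<bullet> y"])
  then show ?thesis
    unfolding det_matrix_rank_one_update energy_mult_cm_boost G_def[symmetric] s_def[symmetric]
    using s G by (simp add: field_simps power2_eq_square)
qed

section \<open>Polar coordinates\<close>

lemma sets_sphere_measure: "sets sphere_measure = sets (restrict_space borel (sphere 0 1))"
  by (simp add: sphere_measure_def sets_scale_measure)

lemma sgn_measurable_punctured_ball:
  "sgn \<in> restrict_space lborel (ball 0 1 - {0}) \<rightarrow>\<^sub>M restrict_space borel (sphere 0 (1::real) :: (real ^ 3) set)"
proof (rule measurable_restrict_space2)
  show "sgn \<in> space (restrict_space lborel (ball 0 1 - {0})) \<rightarrow> sphere 0 1"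
    by (auto simp: space_restrict_space norm_sgn)
qed (rule measurable_restrict_space1, simp)

lemma emeasure_sphere_measure:
  assumes "B \<in> sets sphere_measure"
  shows "emeasure sphere_measure B = 3 * emeasure lborel {y. y \<noteq> 0 \<and> norm y < 1 \<and> sgn y \<in> B}"
proof -
  have B: "B \<in> sets (restrict_space borel (sphere 0 1))" using assms by (simp add: sets_sphere_measure)
  have "emeasure sphere_measure B = 3 * emeasure (restrict_space lborel (ball 0 1 - {0}))
      (sgn -` B \<inter> space (restrict_space lborel (ball 0 1 - {0})))"
    unfolding sphere_measure_def
    using emeasure_distr[OF sgn_measurable_punctured_ball B] by (simp add: emeasure_scale_measure)
  also have "sgn -` B \<inter> space (restrict_space lborel (ball 0 1 - {0})) = {y. y \<noteq> 0 \<and> norm y < 1 \<and> sgn y \<in> B}"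
    by (auto simp: space_restrict_space)
  also have "emeasure (restrict_space lborel (ball 0 1 - {0})) \<dots> = emeasure lborel \<dots>"
  proof (rule emeasure_restrict_space)
    show "(ball 0 1 - {0}) \<inter> space lborel \<in> sets (lborel :: (real^3) measure)" by simp
  qed auto
  finally show ?thesis .
qed

lemma sigma_finite_sphere_measure: "sigma_finite_measure sphere_measure"
proof -
  have "finite_measure sphere_measure"
    by (rule finite_measureI) (simp add: space_sphere_measure emeasure_sphere_measure_total)
  then show ?thesis by (simp add: finite_measure.axioms)
qed

text \<open>The value at 0 only serves to make the map total into the sphere.\<close>

definition unit_dir :: "real ^ 3 \<Rightarrow> real ^ 3" where
  "unit_dir y = (if y = 0 then axis 1 1 else sgn y)"

lemma unit_dir_measurable [measurable]: "unit_dir \<in> borel \<rightarrow>\<^sub>M sphere_measure"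
proof -
  have "unit_dir \<in> borel \<rightarrow>\<^sub>M restrict_space borel (sphere 0 1)"
  proof (rule measurable_restrict_space2)
    show "unit_dir \<in> space borel \<rightarrow> sphere 0 1" by (auto simp: unit_dir_def norm_sgn)
    show "unit_dir \<in> borel_measurable borel" unfolding unit_dir_def by measurable
  qed
  then show ?thesis
    by (simp add: measurable_cong_sets[OF refl sets_sphere_measure])
qed

lemma id_measurable_sphere [measurable]: "(\<lambda>\<omega>. \<omega>) \<in> sphere_measure \<rightarrow>\<^sub>M borel"
  by (subst measurable_cong_sets[OF sets_sphere_measure refl]) (rule measurable_restrict_space1, simp)

lemma emeasure_cone_scale:
  fixes B :: "(real ^ 3) set"
  assumes [measurable]: "B \<in> sets borel" and R: "R > 0"
  shows "emeasure lborel {y. y \<noteq> 0 \<and> norm y < R \<and> sgn y \<in> B} =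
           ennreal (R ^ 3) * emeasure lborel {y. y \<noteq> 0 \<and> norm y < 1 \<and> sgn y \<in> B}"
proof -
  have [measurable]: "{y. y \<noteq> 0 \<and> norm y < r \<and> sgn y \<in> B} \<in> sets borel" for r
    by measurable
  have "emeasure lborel {y. y \<noteq> 0 \<and> norm y < R \<and> sgn y \<in> B} =
      emeasure (density (distr lborel borel (\<lambda>x. 0 + R *\<^sub>R x)) (\<lambda>_. ennreal (\<bar>R\<bar> ^ DIM(real ^ 3))))
        {y. y \<noteq> 0 \<and> norm y < R \<and> sgn y \<in> B}"
    using R by (subst lborel_affine[of R 0]) auto
  also have "\<dots> = ennreal (R ^ 3) * emeasure lborel ((\<lambda>x. R *\<^sub>R x) -` {y. y \<noteq> 0 \<and> norm y < R \<and> sgn y \<in> B})"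
    using R by (subst emeasure_density) (auto simp: nn_integral_cmult emeasure_distr)
  also have "(\<lambda>x. R *\<^sub>R x) -` {y. y \<noteq> 0 \<and> norm y < R \<and> sgn y \<in> B} = {y. y \<noteq> 0 \<and> norm y < 1 \<and> sgn y \<in> B}"
    using R by (auto simp: sgn_scaleR)
  finally show ?thesis .
qed

text \<open>The measure r^2 dr on r > 0, made a measure of its own so that polar coordinates become
  an equality with a product measure.\<close>

definition radial_measure :: "real measure" where
  "radial_measure = density lborel (\<lambda>r. ennreal (r\<^sup>2) * indicator {0<..} r)"

lemma sets_radial_measure [measurable_cong]: "sets radial_measure = sets borel"
  by (simp add: radial_measure_def)

lemma sigma_finite_radial_measure: "sigma_finite_measure radial_measure"
  unfolding radial_measure_def
  by (subst sigma_finite_measure.sigma_finite_iff_density_finite[OF lborel.sigma_finite_measure_axioms]) (auto simp: indicator_def)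

lemma emeasure_radial_lessThan: "emeasure radial_measure {..<R} = ennreal ((max 0 R) ^ 3 / 3)"
proof -
  have "emeasure radial_measure {..<R} =
      (\<integral>\<^sup>+r. ennreal (r\<^sup>2) * indicator {0<..} r * indicator {..<R} r \<partial>lborel)"
    unfolding radial_measure_def by (subst emeasure_density) auto
  \<comment> \<open>End points are null, which allows the closed interval of the fundamental
    theorem; \<open>max 0 R\<close> makes it a single point when R \<le> 0.\<close>
  also have "\<dots> = (\<integral>\<^sup>+r. ennreal (r\<^sup>2) * indicator {0..max 0 R} r \<partial>lborel)"
    by (rule nn_integral_cong_AE)
      (use AE_lborel_singleton[of 0] AE_lborel_singleton[of "max 0 R"] in \<open>eventually_elim, auto simp: indicator_def\<close>)
  also have "\<dots> = ennreal ((max 0 R) ^ 3 / 3 - 0 ^ 3 / 3)"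
    by (rule nn_integral_FTC_Icc) (auto intro!: derivative_eq_intros simp: power2_eq_square)
  finally show ?thesis by simp
qed

text \<open>Rectangles determine the product measure. For a fixed set B of directions both sides are
  measures in the radius, determined by half-lines, and there the scaling of cones gives R^3 / 3
  times the area of B.\<close>

lemma polar_product_measure:
  "radial_measure \<Otimes>\<^sub>M sphere_measure =
     distr lborel (borel \<Otimes>\<^sub>M sphere_measure) (\<lambda>y. (norm y, unit_dir y))"
proof (rule pair_measure_eqI)
  show "sets (radial_measure \<Otimes>\<^sub>M sphere_measure) =
      sets (distr lborel (borel \<Otimes>\<^sub>M sphere_measure) (\<lambda>y. (norm y, unit_dir y)))"
    by (simp add: sets_radial_measure cong: sets_pair_measure_cong)
  fix A B assume A: "A \<in> sets radial_measure" and B: "B \<in> sets sphere_measure"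
  note [measurable] = B
  have Bb [measurable]: "B \<in> sets borel"
    using B unfolding sets_sphere_measure by (auto simp: sets_restrict_space)
  define M where "M = scale_measure (emeasure sphere_measure B) radial_measure"
  define N where "N = distr (restrict_space lborel {y. unit_dir y \<in> B}) borel (norm :: real ^ 3 \<Rightarrow> real)"
  have [measurable]: "{y. unit_dir y \<in> B} \<in> sets borel"
    using measurable_sets[OF unit_dir_measurable B] by (simp add: vimage_def)
  have [measurable]: "norm \<in> restrict_space lborel {y. unit_dir y \<in> B} \<rightarrow>\<^sub>M (borel :: real measure)"
    by (rule measurable_restrict_space1) simp
  have N: "emeasure N A = emeasure lborel {y. norm y \<in> A \<and> unit_dir y \<in> B}" if "A \<in> sets borel" for A
  proof -
    have "emeasure N A = emeasure (restrict_space lborel {y. unit_dir y \<in> B})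
        (norm -` A \<inter> space (restrict_space lborel {y. unit_dir y \<in> B}))"
      unfolding N_def using that by (intro emeasure_distr) auto
    also have "norm -` A \<inter> space (restrict_space lborel {y. unit_dir y \<in> B}) = {y. norm y \<in> A \<and> unit_dir y \<in> B}"
      by (auto simp: space_restrict_space)
    also have "emeasure (restrict_space lborel {y. unit_dir y \<in> B}) \<dots> = emeasure lborel \<dots>"
      by (rule emeasure_restrict_space) auto
    finally show ?thesis .
  qed
  have fin: "emeasure sphere_measure B < \<infinity>"
  proof -
    have "emeasure sphere_measure B \<le> emeasure sphere_measure (sphere 0 1)"
      using emeasure_space[of sphere_measure B] by (simp add: space_sphere_measure)
    then show ?thesis by (simp add: emeasure_sphere_measure_total order_le_less_trans)
  qed
  have "M = N"
  proof (rule measure_eqI_generator_eq[where E = "range lessThan" and \<Omega> = UNIV and A = "\<lambda>n. {..<real n}"])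
    have "{..<a} \<inter> {..<b} = {..<min a b}" for a b :: real by auto
    then show "Int_stable (range lessThan :: real set set)"
      by (auto simp: Int_stable_def)
    show "sets M = sigma_sets UNIV (range lessThan)" "sets N = sigma_sets UNIV (range lessThan)"
      by (simp_all add: M_def N_def sets_scale_measure sets_radial_measure borel_Iio)
    show "(\<Union>n. {..<real n}) = UNIV" using reals_Archimedean2 by auto
    show "emeasure M {..<real i} \<noteq> \<infinity>" for i
      using fin by (simp add: M_def emeasure_scale_measure emeasure_radial_lessThan ennreal_mult_eq_top_iff)
    fix X :: "real set" assume "X \<in> range lessThan"
    then obtain R where X: "X = {..<R}" by auto
    show "emeasure M X = emeasure N X"
    proof (cases "R > 0")
      case False
      then have empty: "{y :: real ^ 3. norm y \<in> X \<and> unit_dir y \<in> B} = {}"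
        unfolding X by (auto simp: not_less) (meson norm_ge_zero order_less_le_trans not_le)
      have "emeasure N X = emeasure lborel {y :: real ^ 3. norm y \<in> X \<and> unit_dir y \<in> B}"
        by (rule N) (simp add: X)
      also have "\<dots> = 0" by (simp only: empty emeasure_empty)
      finally show ?thesis using False
        by (simp add: M_def X emeasure_scale_measure emeasure_radial_lessThan)
    next
      case True
      have "emeasure N X = emeasure lborel {y. norm y < R \<and> unit_dir y \<in> B}"
        by (subst N) (auto simp: X)
      also have "\<dots> = emeasure lborel {y. y \<noteq> 0 \<and> norm y < R \<and> sgn y \<in> B}"
        by (rule emeasure_eq_AE)
          (use AE_lborel_singleton[of 0] in \<open>eventually_elim, auto simp: unit_dir_def\<close>, measurable)
      also have "\<dots> = ennreal (R ^ 3 / 3) * emeasure sphere_measure B"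
      proof -
        \<comment> \<open>The factor 3 of the cone measure meets the 1/3 from integrating
          r^2.\<close>
        have "ennreal (R ^ 3) = ennreal (R ^ 3 / 3) * 3"
          using True by (simp flip: ennreal_numeral ennreal_mult')
        then show ?thesis
          unfolding emeasure_cone_scale[OF Bb True] emeasure_sphere_measure[OF B]
          by (simp add: mult.assoc)
      qed
      finally show ?thesis
        using True by (simp add: M_def X emeasure_scale_measure emeasure_radial_lessThan mult.commute)
    qed
  qed auto
  then have "emeasure radial_measure A * emeasure sphere_measure B = emeasure N A"
    by (metis M_def emeasure_scale_measure mult.commute)
  also have "\<dots> = emeasure lborel {y. norm y \<in> A \<and> unit_dir y \<in> B}"
    using A by (intro N) (simp add: sets_radial_measure)
  also have "\<dots> = emeasure (distr lborel (borel \<Otimes>\<^sub>M sphere_measure) (\<lambda>y. (norm y, unit_dir y))) (A \<times> B)"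
    using A by (subst emeasure_distr) (auto simp: sets_radial_measure intro!: arg_cong2[where f = emeasure])
  finally show "emeasure radial_measure A * emeasure sphere_measure B = \<dots>" .
qed (rule sigma_finite_radial_measure sigma_finite_sphere_measure)+

interpretation sphere: sigma_finite_measure sphere_measure
  by (rule sigma_finite_sphere_measure)

interpretation radial: sigma_finite_measure radial_measure
  by (rule sigma_finite_radial_measure)

interpretation radial_sphere: pair_sigma_finite radial_measure sphere_measure ..

interpretation sphere_sphere: pair_sigma_finite sphere_measure sphere_measure ..

lemma nn_integral_polar:
  assumes [measurable]: "h \<in> borel_measurable (borel :: (real ^ 3) measure)"
  shows "(\<integral>\<^sup>+y. h y \<partial>lborel) = (\<integral>\<^sup>+r. (\<integral>\<^sup>+\<omega>. h (r *\<^sub>R \<omega>) \<partial>sphere_measure) \<partial>radial_measure)"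
proof -
  have "(\<integral>\<^sup>+y. h y \<partial>lborel) = (\<integral>\<^sup>+y. h (norm y *\<^sub>R unit_dir y) \<partial>lborel)"
    by (auto simp: unit_dir_def sgn_div_norm intro!: nn_integral_cong)
  also have "\<dots> = (\<integral>\<^sup>+z. h (fst z *\<^sub>R snd z)
      \<partial>distr lborel (borel \<Otimes>\<^sub>M sphere_measure) (\<lambda>y. (norm y, unit_dir y)))"
    by (subst nn_integral_distr) auto
  also have "\<dots> = (\<integral>\<^sup>+z. h (fst z *\<^sub>R snd z) \<partial>(radial_measure \<Otimes>\<^sub>M sphere_measure))"
    by (simp add: polar_product_measure)
  also have "\<dots> = (\<integral>\<^sup>+r. (\<integral>\<^sup>+\<omega>. h (r *\<^sub>R \<omega>) \<partial>sphere_measure) \<partial>radial_measure)"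
    by (subst sphere.nn_integral_fst[symmetric]) auto
  finally show ?thesis .
qed

section \<open>The collisional change of variables\<close>

definition cm_pair :: "real ^ 3 \<Rightarrow> real ^ 3 \<Rightarrow> (real ^ 3) \<times> (real ^ 3)" where
  "cm_pair P y = ((1/2) *\<^sub>R P + cm_boost P y, (1/2) *\<^sub>R P - cm_boost P y)"

lemma measurable_boost_factor [measurable (raw)]:
  assumes [measurable]: "f \<in> borel_measurable M" "g \<in> borel_measurable M"
  shows "(\<lambda>x. boost_factor (f x) (g x)) \<in> borel_measurable M"
  unfolding boost_factor_def by measurable

lemma measurable_cm_boost [measurable (raw)]:
  assumes [measurable]: "f \<in> borel_measurable M" "g \<in> borel_measurable M"
  shows "(\<lambda>x. cm_boost (f x) (g x)) \<in> borel_measurable M"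
  unfolding cm_boost_def by measurable

lemma measurable_cm_pair [measurable (raw)]:
  assumes [measurable]: "f \<in> borel_measurable M" "g \<in> borel_measurable M"
  shows "(\<lambda>x. cm_pair (f x) (g x)) \<in> M \<rightarrow>\<^sub>M borel \<Otimes>\<^sub>M borel"
  unfolding cm_pair_def by measurable

lemma measurable_energy [measurable]: "energy \<in> borel_measurable borel"
  unfolding energy_def[abs_def] by measurable

lemma measurable_rel_momentum [measurable (raw)]:
  assumes [measurable]: "f \<in> borel_measurable M" "g \<in> borel_measurable M"
  shows "(\<lambda>x. rel_momentum (f x) (g x)) \<in> borel_measurable M"
  unfolding rel_momentum_def by measurable

lemma measurable_moller_velocity [measurable (raw)]:
  assumes [measurable]: "f \<in> borel_measurable M" "g \<in> borel_measurable M"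
  shows "(\<lambda>x. moller_velocity (f x) (g x)) \<in> borel_measurable M"
  unfolding moller_velocity_def cm_energy_sq_def by measurable

lemma measurable_post [measurable (raw)]:
  assumes [measurable]: "f \<in> borel_measurable M" "g \<in> borel_measurable M" "h \<in> borel_measurable M"
  shows "(\<lambda>x. post_p (f x) (g x) (h x)) \<in> borel_measurable M"
    and "(\<lambda>x. post_q (f x) (g x) (h x)) \<in> borel_measurable M"
  unfolding post_p_def post_q_def collision_dir_def lorentz_factor_def cm_energy_sq_def
  by measurable

lemma nn_integral_lborel_isometric_affine:
  fixes t :: "'a :: euclidean_space"
  assumes "\<bar>c\<bar> = 1" and [measurable]: "f \<in> borel_measurable borel"
  shows "(\<integral>\<^sup>+x. f x \<partial>lborel) = (\<integral>\<^sup>+x. f (t + c *\<^sub>R x) \<partial>lborel)"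
proof -
  have "c \<noteq> 0" using assms(1) by auto
  then show ?thesis
    by (subst lborel_affine[of c t]) (simp_all add: assms(1) density_1 nn_integral_distr)
qed

text \<open>Three substitutions, each with the other variable fixed: q = P - p, then p = P / 2 + d,
  then d = \<open>cm_boost P y\<close>. Only the last has a nontrivial Jacobian, so a determinant in
  dimension 3 replaces one in dimension 6.\<close>

lemma nn_integral_cm_coordinates:
  assumes [measurable]: "\<Phi> \<in> borel_measurable (borel \<Otimes>\<^sub>M borel)"
  shows "(\<integral>\<^sup>+p. (\<integral>\<^sup>+q. \<Phi> (p, q) \<partial>lborel) \<partial>lborel) =
    (\<integral>\<^sup>+P. (\<integral>\<^sup>+y. ennreal (energy (fst (cm_pair P y)) * energy (snd (cm_pair P y))
        / ((1 + (norm y)\<^sup>2) * boost_factor P y)) * \<Phi> (cm_pair P y) \<partial>lborel) \<partial>lborel)"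
proof -
  \<comment> \<open>The factor \<open>1 *\<^sub>R\<close> displays the translation in the affine
    form t + c x with c = 1.\<close>
  have "(\<integral>\<^sup>+p. (\<integral>\<^sup>+q. \<Phi> (p, q) \<partial>lborel) \<partial>lborel) = (\<integral>\<^sup>+p. (\<integral>\<^sup>+P. \<Phi> (p, - p + 1 *\<^sub>R P) \<partial>lborel) \<partial>lborel)"
    by (intro nn_integral_cong nn_integral_lborel_isometric_affine) auto
  also have "\<dots> = (\<integral>\<^sup>+P. (\<integral>\<^sup>+p. \<Phi> (p, - p + 1 *\<^sub>R P) \<partial>lborel) \<partial>lborel)"
    by (rule lborel_pair.Fubini'[symmetric]) measurable
  also have "\<dots> = (\<integral>\<^sup>+P. (\<integral>\<^sup>+d. \<Phi> ((1/2) *\<^sub>R P + 1 *\<^sub>R d, - ((1/2) *\<^sub>R P + 1 *\<^sub>R d) + 1 *\<^sub>R P) \<partial>lborel) \<partial>lborel)"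
    by (intro nn_integral_cong nn_integral_lborel_isometric_affine) auto
  also have "\<dots> = (\<integral>\<^sup>+P. (\<integral>\<^sup>+d. \<Phi> ((1/2) *\<^sub>R P + d, (1/2) *\<^sub>R P - d) \<partial>lborel) \<partial>lborel)"
  proof -
    have *: "- ((1/2) *\<^sub>R P + 1 *\<^sub>R d) + 1 *\<^sub>R P = (1/2) *\<^sub>R P - d" for P d :: "real ^ 3"
      by (simp add: vec_eq_iff)
    show ?thesis unfolding * by simp
  qed
  also have "\<dots> = (\<integral>\<^sup>+P. (\<integral>\<^sup>+y. ennreal \<bar>det (matrix (\<lambda>h. h + (boost_gradient P y \<bullet> h) *\<^sub>R P))\<bar> *
      \<Phi> ((1/2) *\<^sub>R P + cm_boost P y, (1/2) *\<^sub>R P - cm_boost P y) \<partial>lborel) \<partial>lborel)"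
  proof (rule nn_integral_cong)
    fix P :: "real ^ 3"
    have bij: "bij (cm_boost P)" by (rule bijI) (rule inj_cm_boost surj_cm_boost)+
    have "(\<lambda>y. det (matrix (\<lambda>h. h + (boost_gradient P y \<bullet> h) *\<^sub>R P))) \<in> borel_measurable borel"
      unfolding det_cm_boost by measurable
    from nn_integral_change_of_variables[OF has_derivative_cm_boost bij this,
        of "\<lambda>d. \<Phi> ((1/2) *\<^sub>R P + d, (1/2) *\<^sub>R P - d)"]
    show "(\<integral>\<^sup>+d. \<Phi> ((1/2) *\<^sub>R P + d, (1/2) *\<^sub>R P - d) \<partial>lborel) =
      (\<integral>\<^sup>+y. ennreal \<bar>det (matrix (\<lambda>h. h + (boost_gradient P y \<bullet> h) *\<^sub>R P))\<bar> *
      \<Phi> ((1/2) *\<^sub>R P + cm_boost P y, (1/2) *\<^sub>R P - cm_boost P y) \<partial>lborel)"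
      by measurable
  qed
  also have "\<dots> = (\<integral>\<^sup>+P. (\<integral>\<^sup>+y. ennreal (energy (fst (cm_pair P y)) * energy (snd (cm_pair P y))
        / ((1 + (norm y)\<^sup>2) * boost_factor P y)) * \<Phi> (cm_pair P y) \<partial>lborel) \<partial>lborel)"
  proof (intro nn_integral_cong)
    fix P y :: "real ^ 3"
    have "0 \<le> energy (fst (cm_pair P y)) * energy (snd (cm_pair P y)) / ((1 + (norm y)\<^sup>2) * boost_factor P y)"
      using energy_ge_1[of "fst (cm_pair P y)"] energy_ge_1[of "snd (cm_pair P y)"] boost_factor_ge_1[of P y]
      by (intro divide_nonneg_nonneg mult_nonneg_nonneg) auto
    from abs_of_nonneg[OF this]
    show "ennreal \<bar>det (matrix (\<lambda>h. h + (boost_gradient P y \<bullet> h) *\<^sub>R P))\<bar> *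
          \<Phi> ((1/2) *\<^sub>R P + cm_boost P y, (1/2) *\<^sub>R P - cm_boost P y) =
        ennreal (energy (fst (cm_pair P y)) * energy (snd (cm_pair P y))
        / ((1 + (norm y)\<^sup>2) * boost_factor P y)) * \<Phi> (cm_pair P y)"
      unfolding det_cm_boost cm_pair_def fst_conv snd_conv by (rule arg_cong)
  qed
  finally show ?thesis .
qed

text \<open>What is left of Jacobian times Moller velocity once p0 q0 has cancelled. The root
  containing P is \<open>boost_factor\<close> with the number r in place of |y|.\<close>

definition cm_density :: "real ^ 3 \<Rightarrow> real \<Rightarrow> real" where
  "cm_density P r = 4 * r * sqrt (1 + r\<^sup>2) / ((1 + r\<^sup>2) * sqrt (1 + (norm P)\<^sup>2 / (4 * (1 + r\<^sup>2))))"

lemma jacobian_moller_velocity: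
  "energy (fst (cm_pair P y)) * energy (snd (cm_pair P y)) / ((1 + (norm y)\<^sup>2) * boost_factor P y)
     * moller_velocity (fst (cm_pair P y)) (snd (cm_pair P y)) = cm_density P (norm y)"
  using energy_ge_1[of "fst (cm_pair P y)"] energy_ge_1[of "snd (cm_pair P y)"]
  unfolding cm_density_def boost_factor_def[symmetric]
  by (simp add: cm_pair_def moller_velocity_cm_boost)

lemma AE_radial_pos: "AE r in radial_measure. 0 < r"
  unfolding radial_measure_def by (subst AE_density) (auto simp: indicator_def)

lemma norm_sphere_measure: "\<omega> \<in> space sphere_measure \<Longrightarrow> norm \<omega> = 1"
  by (simp add: space_sphere_measure)

text \<open>The collision measure becomes a function of P and r times dP r^2 dr d\<eta> d\<omega>,
  where \<eta> is the direction of y. Only K distinguishes \<eta> from \<omega>.\<close>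

lemma nn_integral_collision_polar:
  assumes [measurable]: "K \<in> borel_measurable ((borel \<Otimes>\<^sub>M borel) \<Otimes>\<^sub>M (borel \<Otimes>\<^sub>M borel))"
  shows "(\<integral>\<^sup>+p. (\<integral>\<^sup>+q. (\<integral>\<^sup>+\<omega>. ennreal (moller_velocity p q)
            * K ((p, q), (post_p p q \<omega>, post_q p q \<omega>)) \<partial>sphere_measure) \<partial>lborel) \<partial>lborel) =
    (\<integral>\<^sup>+P. (\<integral>\<^sup>+r. (\<integral>\<^sup>+\<eta>. (\<integral>\<^sup>+\<omega>. ennreal (cm_density P r) *
        K (cm_pair P (r *\<^sub>R \<eta>), cm_pair P (r *\<^sub>R \<omega>)) \<partial>sphere_measure) \<partial>sphere_measure) \<partial>radial_measure) \<partial>lborel)"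
proof -
  define \<Phi> where "\<Phi> = (\<lambda>(p, q). \<integral>\<^sup>+\<omega>. ennreal (moller_velocity p q)
            * K ((p, q), (post_p p q \<omega>, post_q p q \<omega>)) \<partial>sphere_measure)"
  have [measurable]: "\<Phi> \<in> borel_measurable (borel \<Otimes>\<^sub>M borel)"
    unfolding \<Phi>_def by measurable
  have [measurable]: "(\<lambda>x. cm_density (f x) (g x)) \<in> borel_measurable M"
    if [measurable]: "f \<in> borel_measurable M" "g \<in> borel_measurable M" for f g and M :: "'z measure"
    unfolding cm_density_def by measurable
  have "(\<integral>\<^sup>+p. (\<integral>\<^sup>+q. (\<integral>\<^sup>+\<omega>. ennreal (moller_velocity p q)
            * K ((p, q), (post_p p q \<omega>, post_q p q \<omega>)) \<partial>sphere_measure) \<partial>lborel) \<partial>lborel) =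
        (\<integral>\<^sup>+p. (\<integral>\<^sup>+q. \<Phi> (p, q) \<partial>lborel) \<partial>lborel)"
    by (simp add: \<Phi>_def)
  also have "\<dots> = (\<integral>\<^sup>+P. (\<integral>\<^sup>+y. ennreal (energy (fst (cm_pair P y)) * energy (snd (cm_pair P y))
        / ((1 + (norm y)\<^sup>2) * boost_factor P y)) * \<Phi> (cm_pair P y) \<partial>lborel) \<partial>lborel)"
    by (rule nn_integral_cm_coordinates) measurable
  also have "\<dots> = (\<integral>\<^sup>+P. (\<integral>\<^sup>+y. (\<integral>\<^sup>+\<omega>. ennreal (cm_density P (norm y)) *
        K (cm_pair P y, cm_pair P (norm y *\<^sub>R \<omega>)) \<partial>sphere_measure) \<partial>lborel) \<partial>lborel)"
  proof (intro nn_integral_cong)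
    fix P y :: "real ^ 3"
    let ?J = "energy (fst (cm_pair P y)) * energy (snd (cm_pair P y)) / ((1 + (norm y)\<^sup>2) * boost_factor P y)"
    let ?v = "moller_velocity (fst (cm_pair P y)) (snd (cm_pair P y))"
    have J: "0 \<le> ?J"
      using energy_ge_1[of "fst (cm_pair P y)"] energy_ge_1[of "snd (cm_pair P y)"] boost_factor_ge_1[of P y]
      by (intro divide_nonneg_nonneg mult_nonneg_nonneg) auto
    have "\<Phi> (cm_pair P y) = (\<integral>\<^sup>+\<omega>. ennreal ?v * K (cm_pair P y, cm_pair P (norm y *\<^sub>R \<omega>)) \<partial>sphere_measure)"
      unfolding \<Phi>_def cm_pair_def prod.case
      by (rule nn_integral_cong) (simp add: post_cm_boost norm_sphere_measure)
    then have "ennreal ?J * \<Phi> (cm_pair P y) =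
        (\<integral>\<^sup>+\<omega>. ennreal ?J * (ennreal ?v * K (cm_pair P y, cm_pair P (norm y *\<^sub>R \<omega>))) \<partial>sphere_measure)"
      by (simp add: nn_integral_cmult)
    also have "\<dots> = (\<integral>\<^sup>+\<omega>. ennreal (cm_density P (norm y)) * K (cm_pair P y, cm_pair P (norm y *\<^sub>R \<omega>)) \<partial>sphere_measure)"
      unfolding mult.assoc[symmetric] ennreal_mult'[OF J, symmetric] jacobian_moller_velocity ..
    finally show "ennreal ?J * \<Phi> (cm_pair P y) = \<dots>" .
  qed
  also have "\<dots> = (\<integral>\<^sup>+P. (\<integral>\<^sup>+r. (\<integral>\<^sup>+\<eta>. (\<integral>\<^sup>+\<omega>. ennreal (cm_density P (norm (r *\<^sub>R \<eta>))) *
        K (cm_pair P (r *\<^sub>R \<eta>), cm_pair P (norm (r *\<^sub>R \<eta>) *\<^sub>R \<omega>)) \<partial>sphere_measure) \<partial>sphere_measure)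
        \<partial>radial_measure) \<partial>lborel)"
    by (intro nn_integral_cong nn_integral_polar) measurable
  also have "\<dots> = (\<integral>\<^sup>+P. (\<integral>\<^sup>+r. (\<integral>\<^sup>+\<eta>. (\<integral>\<^sup>+\<omega>. ennreal (cm_density P r) *
        K (cm_pair P (r *\<^sub>R \<eta>), cm_pair P (r *\<^sub>R \<omega>)) \<partial>sphere_measure) \<partial>sphere_measure) \<partial>radial_measure) \<partial>lborel)"
  \<comment> \<open>The norm of r \<eta> is r only for r \<ge> 0, which holds almost everywhere for
    the radial measure.\<close>
  proof (rule nn_integral_cong, rule nn_integral_cong_AE)
    fix P :: "real ^ 3"
    show "AE r in radial_measure. (\<integral>\<^sup>+\<eta>. (\<integral>\<^sup>+\<omega>. ennreal (cm_density P (norm (r *\<^sub>R \<eta>))) *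
        K (cm_pair P (r *\<^sub>R \<eta>), cm_pair P (norm (r *\<^sub>R \<eta>) *\<^sub>R \<omega>)) \<partial>sphere_measure) \<partial>sphere_measure) =
        (\<integral>\<^sup>+\<eta>. (\<integral>\<^sup>+\<omega>. ennreal (cm_density P r) *
        K (cm_pair P (r *\<^sub>R \<eta>), cm_pair P (r *\<^sub>R \<omega>)) \<partial>sphere_measure) \<partial>sphere_measure)"
      using AE_radial_pos
      by eventually_elim (auto intro!: nn_integral_cong simp: norm_sphere_measure)
  qed
  finally show ?thesis .
qed

text \<open>In polar form, exchanging the pairs before and after the collision means exchanging
  \<eta> and \<omega>, which is Tonelli's theorem on the product of two spheres.\<close>

lemma collision_change_of_variables:
  assumes [measurable]: "K \<in> borel_measurable ((borel \<Otimes>\<^sub>M borel) \<Otimes>\<^sub>M (borel \<Otimes>\<^sub>M borel))"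
  shows "(\<integral>\<^sup>+p. (\<integral>\<^sup>+q. (\<integral>\<^sup>+\<omega>. ennreal (moller_velocity p q)
            * K ((p, q), (post_p p q \<omega>, post_q p q \<omega>)) \<partial>sphere_measure) \<partial>lborel) \<partial>lborel) =
         (\<integral>\<^sup>+p. (\<integral>\<^sup>+q. (\<integral>\<^sup>+\<omega>. ennreal (moller_velocity p q)
            * K ((post_p p q \<omega>, post_q p q \<omega>), (p, q)) \<partial>sphere_measure) \<partial>lborel) \<partial>lborel)"
proof -
  define K' where "K' = (\<lambda>(a, b). K (b, a))"
  have [measurable]: "K' \<in> borel_measurable ((borel \<Otimes>\<^sub>M borel) \<Otimes>\<^sub>M (borel \<Otimes>\<^sub>M borel))"
    unfolding K'_def by measurable
  have "(\<integral>\<^sup>+P. (\<integral>\<^sup>+r. (\<integral>\<^sup>+\<eta>. (\<integral>\<^sup>+\<omega>. ennreal (cm_density P r) *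
        K (cm_pair P (r *\<^sub>R \<eta>), cm_pair P (r *\<^sub>R \<omega>)) \<partial>sphere_measure) \<partial>sphere_measure) \<partial>radial_measure) \<partial>lborel) =
      (\<integral>\<^sup>+P. (\<integral>\<^sup>+r. (\<integral>\<^sup>+\<eta>. (\<integral>\<^sup>+\<omega>. ennreal (cm_density P r) *
        K' (cm_pair P (r *\<^sub>R \<eta>), cm_pair P (r *\<^sub>R \<omega>)) \<partial>sphere_measure) \<partial>sphere_measure) \<partial>radial_measure) \<partial>lborel)"
    unfolding K'_def prod.case
    by (intro nn_integral_cong sphere_sphere.Fubini'[symmetric]) measurable
  then show ?thesis
    by (simp add: nn_integral_collision_polar[of K] nn_integral_collision_polar[of K', unfolded K'_def prod.case]
        K'_def)
qed

section \<open>The angular potential\<close>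

lemma nn_integral_radial:
  assumes [measurable]: "f \<in> borel_measurable borel"
  shows "(\<integral>\<^sup>+r. f r \<partial>radial_measure) = (\<integral>\<^sup>+r. ennreal (r\<^sup>2) * indicator {0<..} r * f r \<partial>lborel)"
  unfolding radial_measure_def by (rule nn_integral_density) measurable

text \<open>With \<open>t = |\<omega> - b|\<close>, write \<open>1/t = 1/(1+t) + \<integral> dr / (r - 1 + t)\<^sup>2\<close> over \<open>1 \<le> r \<le> 2\<close> and use
  \<open>|r\<omega> - b| \<le> r - 1 + t\<close>. This trades the spherical potential for the locally integrable
  kernel \<open>1/|y - b|\<^sup>2\<close> in space, and no rotation invariance is needed.\<close>

lemma inverse_dist_le_radial_integral:
  fixes \<omega> b :: "real ^ 3"
  assumes "norm \<omega> = 1"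
  shows "ennreal (1 / norm (\<omega> - b)) \<le>
    1 + (\<integral>\<^sup>+r. indicator {1..2} (norm (r *\<^sub>R \<omega>)) * ennreal (1 / (norm (r *\<^sub>R \<omega> - b))\<^sup>2) \<partial>radial_measure)"
proof (cases "\<omega> = b")
  case False
  define t where "t = norm (\<omega> - b)"
  have t: "t > 0" using False by (simp add: t_def)
  have "ennreal (1 / t - 1 / (1 + t)) = (\<integral>\<^sup>+r\<in>{1..2}. ennreal (1 / (r - 1 + t)\<^sup>2) \<partial>lborel)"
  proof -
    have "(\<integral>\<^sup>+r\<in>{1..2}. ennreal (1 / (r - 1 + t)\<^sup>2) \<partial>lborel) = ennreal ((- 1 / (2 - 1 + t)) - (- 1 / (1 - 1 + t)))"
      by (rule nn_integral_FTC_Icc)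
        (use t in \<open>auto intro!: derivative_eq_intros simp: power2_eq_square\<close>)
    then show ?thesis by simp
  qed
  also have "\<dots> \<le> (\<integral>\<^sup>+r. ennreal (r\<^sup>2) * indicator {0<..} r *
      (indicator {1..2} (norm (r *\<^sub>R \<omega>)) * ennreal (1 / (norm (r *\<^sub>R \<omega> - b))\<^sup>2)) \<partial>lborel)"
  proof (rule nn_integral_mono_AE)
    \<comment> \<open>Excluding r = |b| keeps r \<omega> different from b, where 1 / 0 = 0 would
      falsify the inequality.\<close>
    have "ennreal (1 / (r - 1 + t)\<^sup>2) \<le> ennreal (r\<^sup>2) * ennreal (1 / (norm (r *\<^sub>R \<omega> - b))\<^sup>2)"
      if r: "r \<in> {1..2}" "r \<noteq> norm b" for r
    proof -
      have "r *\<^sub>R \<omega> \<noteq> b" using r assms by auto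
      then have pos: "norm (r *\<^sub>R \<omega> - b) > 0" by simp
      have eq: "r *\<^sub>R \<omega> - b = (r - 1) *\<^sub>R \<omega> + (\<omega> - b)" by (simp add: algebra_simps)
      have "norm (r *\<^sub>R \<omega> - b) \<le> r - 1 + t"
        unfolding eq using norm_triangle_ineq[of "(r - 1) *\<^sub>R \<omega>" "\<omega> - b"] r assms by (simp add: t_def)
      then have "(norm (r *\<^sub>R \<omega> - b))\<^sup>2 \<le> (r - 1 + t)\<^sup>2" by (simp add: power_mono)
      then have "1 / (r - 1 + t)\<^sup>2 \<le> 1 / (norm (r *\<^sub>R \<omega> - b))\<^sup>2"
        using pos r t by (intro divide_left_mono mult_pos_pos) auto
      also have "\<dots> \<le> r\<^sup>2 * (1 / (norm (r *\<^sub>R \<omega> - b))\<^sup>2)"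
        using mult_right_mono[OF one_le_power[of r 2], of "1 / (norm (r *\<^sub>R \<omega> - b))\<^sup>2"] r by simp
      finally show ?thesis by (simp only: ennreal_mult'[OF zero_le_power2, symmetric] ennreal_leI)
    qed
    then have "ennreal (1 / (r - 1 + t)\<^sup>2) * indicator {1..2} r \<le>
        ennreal (r\<^sup>2) * indicator {0<..} r *
        (indicator {1..2} (norm (r *\<^sub>R \<omega>)) * ennreal (1 / (norm (r *\<^sub>R \<omega> - b))\<^sup>2))"
      if "r \<noteq> norm b" for r
      using that assms by (cases "r \<in> {1..2}") simp_all
    then show "AE r in lborel. ennreal (1 / (r - 1 + t)\<^sup>2) * indicator {1..2} r \<le>
        ennreal (r\<^sup>2) * indicator {0<..} r *
        (indicator {1..2} (norm (r *\<^sub>R \<omega>)) * ennreal (1 / (norm (r *\<^sub>R \<omega> - b))\<^sup>2))"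
      by (rule eventually_mono[OF AE_lborel_singleton[of "norm b"]])
  qed
  also have "\<dots> = (\<integral>\<^sup>+r. indicator {1..2} (norm (r *\<^sub>R \<omega>)) * ennreal (1 / (norm (r *\<^sub>R \<omega> - b))\<^sup>2) \<partial>radial_measure)"
    by (rule nn_integral_radial[symmetric]) measurable
  finally have *: "ennreal (1 / t - 1 / (1 + t)) \<le> \<dots>" .
  have "ennreal (1 / t) = ennreal (1 / (1 + t)) + ennreal (1 / t - 1 / (1 + t))"
    using t by (subst ennreal_plus[symmetric]) (simp_all add: frac_le)
  also have "\<dots> \<le> 1 + ennreal (1 / t - 1 / (1 + t))"
    using t by (intro add_right_mono) simp
  also note add_left_mono[OF *]
  finally show ?thesis by (simp only: t_def)
qed simp

text \<open>The r^2 of polar coordinates cancels the singularity; the area 4 \<pi> times the length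
  of the radial interval remains.\<close>

lemma nn_integral_inverse_square_ball:
  "(\<integral>\<^sup>+z. indicator {..<1} (norm z) * ennreal (1 / (norm z)\<^sup>2) \<partial>(lborel :: (real ^ 3) measure)) \<le> ennreal (4 * pi)"
proof -
  have "(\<integral>\<^sup>+z. indicator {..<1} (norm z) * ennreal (1 / (norm z)\<^sup>2) \<partial>(lborel :: (real ^ 3) measure)) =
    (\<integral>\<^sup>+r. (\<integral>\<^sup>+\<omega>. indicator {..<1} (norm (r *\<^sub>R \<omega>)) * ennreal (1 / (norm (r *\<^sub>R \<omega>))\<^sup>2) \<partial>sphere_measure) \<partial>radial_measure)"
    by (rule nn_integral_polar) measurable
  also have "\<dots> = (\<integral>\<^sup>+r. (\<integral>\<^sup>+\<omega>. indicator {..<1} \<bar>r\<bar> * ennreal (1 / r\<^sup>2) \<partial>sphere_measure) \<partial>radial_measure)"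
    by (intro nn_integral_cong) (simp add: norm_sphere_measure)
  also have "\<dots> = (\<integral>\<^sup>+r. indicator {..<1} \<bar>r\<bar> * ennreal (1 / r\<^sup>2) * ennreal (4 * pi) \<partial>radial_measure)"
    by (simp add: space_sphere_measure emeasure_sphere_measure_total)
  also have "\<dots> = (\<integral>\<^sup>+r. ennreal (r\<^sup>2) * indicator {0<..} r * (indicator {..<1} \<bar>r\<bar> * ennreal (1 / r\<^sup>2) * ennreal (4 * pi)) \<partial>lborel)"
    by (rule nn_integral_radial) measurable
  also have "\<dots> \<le> (\<integral>\<^sup>+r. ennreal (4 * pi) * indicator {0..1 :: real} r \<partial>lborel)"
  proof (rule nn_integral_mono)
    fix r :: real
    have "ennreal (r\<^sup>2) * ennreal (1 / r\<^sup>2) = 1" if "0 < r"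
      using that by (simp flip: ennreal_mult')
    then show "ennreal (r\<^sup>2) * indicator {0<..} r * (indicator {..<1} \<bar>r\<bar> * ennreal (1 / r\<^sup>2) * ennreal (4 * pi))
        \<le> ennreal (4 * pi) * indicator {0..1} r"
      by (auto simp: indicator_def mult.assoc[symmetric])
  qed
  also have "\<dots> = ennreal (4 * pi)"
    by (simp add: nn_integral_cmult)
  finally show ?thesis .
qed

text \<open>The summand 1 of the pointwise bound integrates to 4 \<pi>; the radial integrals add up
  to the integral of 1 / |y - b|^2 over the shell 1 \<le> |y| \<le> 2. Where |y - b| \<ge> 1 this
  costs at most the volume V of the ball of radius 2, and elsewhere a translation by b reduces it to
  the unit ball.\<close>

lemma angular_potential_bounded:
  "\<exists>A>0. \<forall>b :: real ^ 3. (\<integral>\<^sup>+\<omega>. ennreal (1 / norm (\<omega> - b)) \<partial>sphere_measure) \<le> ennreal A"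
proof -
  define V where "V = measure lborel (cball 0 2 :: (real ^ 3) set)"
  have V: "emeasure lborel (cball 0 2 :: (real ^ 3) set) = ennreal V"
    unfolding V_def
    by (rule emeasure_eq_ennreal_measure) (use emeasure_lborel_cball_finite[of "0 :: real ^ 3" 2] in \<open>simp add: less_top\<close>)
  have bound: "(\<integral>\<^sup>+\<omega>. ennreal (1 / norm (\<omega> - b)) \<partial>sphere_measure) \<le> ennreal (4 * pi + (V + 4 * pi))" for b :: "real ^ 3"
  proof -
    define h where "h = (\<lambda>y :: real ^ 3. indicator {1..2} (norm y) * ennreal (1 / (norm (y - b))\<^sup>2))"
    have [measurable]: "h \<in> borel_measurable borel" unfolding h_def by measurable
    have "(\<integral>\<^sup>+\<omega>. ennreal (1 / norm (\<omega> - b)) \<partial>sphere_measure) \<le>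
        (\<integral>\<^sup>+\<omega>. 1 + (\<integral>\<^sup>+r. h (r *\<^sub>R \<omega>) \<partial>radial_measure) \<partial>sphere_measure)"
      unfolding h_def by (intro nn_integral_mono inverse_dist_le_radial_integral norm_sphere_measure)
    also have "\<dots> = ennreal (4 * pi) + (\<integral>\<^sup>+\<omega>. (\<integral>\<^sup>+r. h (r *\<^sub>R \<omega>) \<partial>radial_measure) \<partial>sphere_measure)"
      by (subst nn_integral_add) (auto simp: space_sphere_measure emeasure_sphere_measure_total)
    also have "(\<integral>\<^sup>+\<omega>. (\<integral>\<^sup>+r. h (r *\<^sub>R \<omega>) \<partial>radial_measure) \<partial>sphere_measure) =
        (\<integral>\<^sup>+r. (\<integral>\<^sup>+\<omega>. h (r *\<^sub>R \<omega>) \<partial>sphere_measure) \<partial>radial_measure)"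
      by (rule radial_sphere.Fubini') measurable
    also have "\<dots> = (\<integral>\<^sup>+y. h y \<partial>lborel)"
      by (rule nn_integral_polar[symmetric]) measurable
    also have "\<dots> \<le> (\<integral>\<^sup>+y. indicator (cball 0 2) y + indicator {..<1} (norm (y - b)) * ennreal (1 / (norm (y - b))\<^sup>2) \<partial>lborel)"
    proof (rule nn_integral_mono)
      fix y :: "real ^ 3"
      have "1 / (norm (y - b))\<^sup>2 \<le> 1" if "1 \<le> norm (y - b)"
        using that power_mono[of 1 "norm (y - b)" 2] by (simp add: divide_le_eq_1)
      then show "h y \<le> indicator (cball 0 2) y + indicator {..<1} (norm (y - b)) * ennreal (1 / (norm (y - b))\<^sup>2)"
        by (auto simp: h_def indicator_def)
    qed
    also have "\<dots> = emeasure lborel (cball 0 2 :: (real ^ 3) set) + (\<integral>\<^sup>+y. indicator {..<1} (norm (y - b)) * ennreal (1 / (norm (y - b))\<^sup>2) \<partial>lborel)"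
      by (subst nn_integral_add; simp add: borel_measurable_indicator)
    also note V
    also have "(\<integral>\<^sup>+y. indicator {..<1} (norm (y - b)) * ennreal (1 / (norm (y - b))\<^sup>2) \<partial>lborel) =
        (\<integral>\<^sup>+y. indicator {..<1} (norm y) * ennreal (1 / (norm y)\<^sup>2) \<partial>(lborel :: (real ^ 3) measure))"
      by (subst nn_integral_lborel_isometric_affine[of 1 _ b]) auto
    also have "\<dots> \<le> ennreal (4 * pi)" by (rule nn_integral_inverse_square_ball)
    finally have "(\<integral>\<^sup>+\<omega>. ennreal (1 / norm (\<omega> - b)) \<partial>sphere_measure) \<le>
        ennreal (4 * pi) + (ennreal V + ennreal (4 * pi))"
      by (simp add: add_left_mono)
    also have "\<dots> = ennreal (4 * pi + (V + 4 * pi))"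
      by (simp add: V_def flip: ennreal_plus)
    finally show ?thesis .
  qed
  show ?thesis
    by (rule exI[of _ "4 * pi + (V + 4 * pi)"]) (use bound in \<open>auto simp: V_def intro!: add_pos_nonneg\<close>)
qed

section \<open>The estimate for a Borel majorant\<close>

text \<open>The angular integral is at most (2 / g) A, so g cancels and v \<le> 4 leaves 8 A. For y
  = 0 the prefactor is 0.\<close>

lemma moller_potential_bounded:
  assumes A: "\<And>b :: real ^ 3. (\<integral>\<^sup>+\<omega>. ennreal (1 / norm (\<omega> - b)) \<partial>sphere_measure) \<le> ennreal A"
    and "0 \<le> A"
  shows "ennreal (moller_velocity p q * rel_momentum p q) *
      (\<integral>\<^sup>+\<omega>. ennreal (1 / norm (post_p p q \<omega> - a)) \<partial>sphere_measure) \<le> ennreal (8 * A)"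
proof -
  obtain P y where pq: "p = (1/2) *\<^sub>R P + cm_boost P y" "q = (1/2) *\<^sub>R P - cm_boost P y"
    by (rule cm_coordinates)
  have g: "rel_momentum p q = 2 * norm y" unfolding pq by (rule rel_momentum_cm_boost)
  show ?thesis
  proof (cases "y = 0")
    case False
    define r where "r = norm y"
    have r: "r > 0" using False by (simp add: r_def)
    define B where "B = (\<lambda>x. x + ((boost_factor P y - 1) * ((P \<bullet> x) / (norm P)\<^sup>2)) *\<^sub>R P)"
    have lin: "linear B"
    proof -
      define c where "c = (boost_factor P y - 1) / (norm P)\<^sup>2"
      have "B = (\<lambda>x. x + (c * (P \<bullet> x)) *\<^sub>R P)" by (simp add: B_def c_def)
      then show ?thesis by (intro linearI) (simp_all add: inner_simps algebra_simps)
    qed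
    have Bge: "norm x \<le> norm (B x)" for x
      unfolding B_def by (rule norm_cm_boost_dir_ge)
    have "x = 0" if "B x = 0" for x
      using Bge[of x] that by simp
    then have "inj B" unfolding linear_injective_0[OF lin] by blast
    then have "surj B" by (rule linear_inj_imp_surj[OF lin])
    \<comment> \<open>The point a pulled back through the affine extension of \<omega> \<mapsto> p'.
      It may lie anywhere in space, which is why A must be uniform in b.\<close>
    then obtain b where b: "B b = (1 / r) *\<^sub>R (a - (1/2) *\<^sub>R P)" by (metis surjD)
    have post: "post_p p q \<omega> - a = r *\<^sub>R B (\<omega> - b)" if "norm \<omega> = 1" for \<omega>
    proof -
      have "boost_factor P (r *\<^sub>R \<omega>) = boost_factor P y"
        by (rule boost_factor_cong) (simp add: r_def that)
      then have "cm_boost P (r *\<^sub>R \<omega>) = r *\<^sub>R B \<omega>"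
        by (simp add: cm_boost_def B_def scaleR_add_right mult_ac)
      then show ?thesis
        unfolding pq post_cm_boost[OF that] r_def[symmetric] linear_diff[OF lin] b
        using r by (simp add: algebra_simps)
    qed
    have "(\<integral>\<^sup>+\<omega>. ennreal (1 / norm (post_p p q \<omega> - a)) \<partial>sphere_measure) \<le>
        (\<integral>\<^sup>+\<omega>. ennreal (1 / r) * ennreal (1 / norm (\<omega> - b)) \<partial>sphere_measure)"
    proof (rule nn_integral_mono)
      fix \<omega> assume "\<omega> \<in> space sphere_measure"
      then have n: "norm \<omega> = 1" by (rule norm_sphere_measure)
      \<comment> \<open>For \<omega> = b both sides are 1 / 0 = 0.\<close>
      have "1 / norm (B (\<omega> - b)) \<le> 1 / norm (\<omega> - b)"
      proof (cases "\<omega> = b")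
        case True
        then show ?thesis by (simp add: linear_0[OF lin])
      next
        case False
        then have "0 < norm (\<omega> - b)" by simp
        with Bge[of "\<omega> - b"] show ?thesis by (intro divide_left_mono mult_pos_pos) auto
      qed
      then have "1 / r * (1 / norm (B (\<omega> - b))) \<le> 1 / r * (1 / norm (\<omega> - b))"
        using r by (intro mult_left_mono) auto
      then show "ennreal (1 / norm (post_p p q \<omega> - a)) \<le> ennreal (1 / r) * ennreal (1 / norm (\<omega> - b))"
        using r unfolding post[OF n] by (simp flip: ennreal_mult')
    qed
    also have "\<dots> \<le> ennreal (1 / r) * ennreal A"
      by (subst nn_integral_cmult) (auto intro!: mult_left_mono A)
    finally have "ennreal (moller_velocity p q * rel_momentum p q) *
      (\<integral>\<^sup>+\<omega>. ennreal (1 / norm (post_p p q \<omega> - a)) \<partial>sphere_measure) \<le>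
      ennreal (moller_velocity p q * rel_momentum p q) * (ennreal (1 / r) * ennreal A)"
      by (rule mult_left_mono) simp
    also have "\<dots> = ennreal (2 * moller_velocity p q * A)"
      using r moller_velocity_nonneg[of p q] \<open>0 \<le> A\<close> by (simp add: g r_def[symmetric] flip: ennreal_mult)
    also have "\<dots> \<le> ennreal (8 * A)"
      using mult_right_mono[OF moller_velocity_le[of p q] \<open>0 \<le> A\<close>] by (intro ennreal_leI) linarith
    finally show ?thesis .
  qed (simp add: g)
qed

lemma weight_post_le:
  assumes "norm \<omega> = 1" "0 < k"
  shows "weight k (post_p p q \<omega>) \<le> weight k p * weight k q"
proof -
  have "energy (post_p p q \<omega>) \<le> energy p + energy q"
    using energy_conservation[OF assms(1), of p q] energy_ge_1[of "post_q p q \<omega>"] by simp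
  then have "k * energy (post_p p q \<omega>) \<le> k * energy p + k * energy q"
    using assms(2) by (simp flip: distrib_left)
  then show ?thesis by (simp add: weight_def flip: exp_add)
qed

lemma rel_momentum_post:
  assumes "norm \<omega> = 1"
  shows "rel_momentum (post_p p q \<omega>) (post_q p q \<omega>) = rel_momentum p q"
proof -
  obtain P y where pq: "p = (1/2) *\<^sub>R P + cm_boost P y" "q = (1/2) *\<^sub>R P - cm_boost P y"
    by (rule cm_coordinates)
  show ?thesis
    unfolding pq post_cm_boost[OF assms] rel_momentum_cm_boost using assms by simp
qed

lemma measurable_weight [measurable]: "weight k \<in> borel_measurable borel"
  unfolding weight_def[abs_def] by measurable

lemma weight_pos: "0 < weight k p"
  by (simp add: weight_def)

text \<open>After the exchange of pairs, F is evaluated at p and q and leaves the \<omega>-integral,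
  while the singular weight sits at p'. Invariance of g keeps v g in place, and the remaining double
  integral factorises into a square.\<close>

lemma weighted_gain_estimate:
  assumes A: "\<And>b :: real ^ 3. (\<integral>\<^sup>+\<omega>. ennreal (1 / norm (\<omega> - b)) \<partial>sphere_measure) \<le> ennreal A"
    and "0 \<le> A" and k: "0 < k"
    and [measurable]: "F \<in> borel_measurable borel"
  shows "(\<integral>\<^sup>+p. ennreal (weight k p / norm (p - a)) *
      (\<integral>\<^sup>+q. (\<integral>\<^sup>+\<omega>. ennreal (moller_velocity p q * rel_momentum p q) *
          (F (post_p p q \<omega>) * F (post_q p q \<omega>)) \<partial>sphere_measure) \<partial>lborel) \<partial>lborel)
    \<le> ennreal (8 * A) * (\<integral>\<^sup>+p. ennreal (weight k p) * F p \<partial>lborel)\<^sup>2"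
proof -
  \<comment> \<open>The first pair carries g and the singular weight, the second pair the majorants;
    v stays outside, as in the exchange formula.\<close>
  define K where "K = (\<lambda>z. ennreal (rel_momentum (fst (fst z)) (snd (fst z))) *
      ennreal (weight k (fst (fst z)) / norm (fst (fst z) - a)) * (F (fst (snd z)) * F (snd (snd z))))"
  have [measurable]: "K \<in> borel_measurable ((borel \<Otimes>\<^sub>M borel) \<Otimes>\<^sub>M (borel \<Otimes>\<^sub>M borel))"
    unfolding K_def by measurable
  have "(\<integral>\<^sup>+p. ennreal (weight k p / norm (p - a)) *
      (\<integral>\<^sup>+q. (\<integral>\<^sup>+\<omega>. ennreal (moller_velocity p q * rel_momentum p q) *
          (F (post_p p q \<omega>) * F (post_q p q \<omega>)) \<partial>sphere_measure) \<partial>lborel) \<partial>lborel) =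
    (\<integral>\<^sup>+p. (\<integral>\<^sup>+q. (\<integral>\<^sup>+\<omega>. ennreal (moller_velocity p q)
            * K ((p, q), (post_p p q \<omega>, post_q p q \<omega>)) \<partial>sphere_measure) \<partial>lborel) \<partial>lborel)"
    unfolding K_def
    by (simp add: ennreal_mult moller_velocity_nonneg rel_momentum_nonneg mult_ac flip: nn_integral_cmult)
  also have "\<dots> = (\<integral>\<^sup>+p. (\<integral>\<^sup>+q. (\<integral>\<^sup>+\<omega>. ennreal (moller_velocity p q)
            * K ((post_p p q \<omega>, post_q p q \<omega>), (p, q)) \<partial>sphere_measure) \<partial>lborel) \<partial>lborel)"
    by (rule collision_change_of_variables) measurable
  also have "\<dots> \<le> (\<integral>\<^sup>+p. (\<integral>\<^sup>+q. ennreal (8 * A) * ((ennreal (weight k p) * F p) * (ennreal (weight k q) * F q)) \<partial>lborel) \<partial>lborel)"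
  proof (intro nn_integral_mono)
    fix p q :: "real ^ 3"
    let ?W = "(ennreal (weight k p) * F p) * (ennreal (weight k q) * F q)"
    let ?vg = "ennreal (moller_velocity p q * rel_momentum p q)"
    have "(\<integral>\<^sup>+\<omega>. ennreal (moller_velocity p q) * K ((post_p p q \<omega>, post_q p q \<omega>), (p, q)) \<partial>sphere_measure) \<le>
        (\<integral>\<^sup>+\<omega>. ?W * (?vg * ennreal (1 / norm (post_p p q \<omega> - a))) \<partial>sphere_measure)"
    proof (rule nn_integral_mono)
      fix \<omega> assume "\<omega> \<in> space sphere_measure"
      then have n: "norm \<omega> = 1" by (rule norm_sphere_measure)
      have "weight k (post_p p q \<omega>) / norm (post_p p q \<omega> - a) \<le>
          weight k p * weight k q * (1 / norm (post_p p q \<omega> - a))"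
        using mult_right_mono[OF weight_post_le[OF n k, of p q], of "1 / norm (post_p p q \<omega> - a)"] by simp
      then have le: "ennreal (weight k (post_p p q \<omega>) / norm (post_p p q \<omega> - a)) \<le>
          ennreal (weight k p) * ennreal (weight k q) * ennreal (1 / norm (post_p p q \<omega> - a))"
        using weight_pos[of k p] weight_pos[of k q] by (simp add: ennreal_leI flip: ennreal_mult)
      have "ennreal (moller_velocity p q) * K ((post_p p q \<omega>, post_q p q \<omega>), (p, q)) =
          (F p * F q * ?vg) * ennreal (weight k (post_p p q \<omega>) / norm (post_p p q \<omega> - a))"
        by (simp add: K_def rel_momentum_post[OF n] ennreal_mult moller_velocity_nonneg rel_momentum_nonneg mult_ac)
      also have "\<dots> \<le> (F p * F q * ?vg) *
          (ennreal (weight k p) * ennreal (weight k q) * ennreal (1 / norm (post_p p q \<omega> - a)))"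
        using le by (rule mult_left_mono) simp
      also have "\<dots> = ?W * (?vg * ennreal (1 / norm (post_p p q \<omega> - a)))"
        by (simp only: mult_ac)
      finally show "ennreal (moller_velocity p q) * K ((post_p p q \<omega>, post_q p q \<omega>), (p, q)) \<le> \<dots>" .
    qed
    also have "\<dots> = ?W * (?vg * (\<integral>\<^sup>+\<omega>. ennreal (1 / norm (post_p p q \<omega> - a)) \<partial>sphere_measure))"
      by (simp add: nn_integral_cmult)
    also have "\<dots> \<le> ?W * ennreal (8 * A)"
      by (intro mult_left_mono moller_potential_bounded A \<open>0 \<le> A\<close>) simp
    finally show "(\<integral>\<^sup>+\<omega>. ennreal (moller_velocity p q) * K ((post_p p q \<omega>, post_q p q \<omega>), (p, q)) \<partial>sphere_measure)
        \<le> ennreal (8 * A) * ?W" by (simp only: mult.commute)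
  qed
  also have "\<dots> = ennreal (8 * A) * (\<integral>\<^sup>+p. ennreal (weight k p) * F p \<partial>lborel)\<^sup>2"
    by (simp add: nn_integral_cmult nn_integral_multc power2_eq_square)
  finally show ?thesis .
qed

section \<open>Measurability and null sets\<close>

text \<open>The exceptional set of an arbitrary Q is enlarged to a Borel null set, whose sections
  are null in either order.\<close>

lemma AE_lborel_pair_swap:
  fixes Q :: "'a::euclidean_space \<times> 'b::euclidean_space \<Rightarrow> bool"
  assumes "AE z in lborel. Q z"
  shows "AE y in lborel. AE x in lborel. Q (x, y)"
proof -
  obtain N where N: "{z \<in> space lborel. \<not> Q z} \<subseteq> N" "emeasure lborel N = 0" "N \<in> sets lborel"
    using assms by (rule AE_E)
  have [measurable]: "N \<in> sets (borel \<Otimes>\<^sub>M borel)"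
    using N(3) unfolding borel_prod by simp
  have "AE z in lborel \<Otimes>\<^sub>M lborel. z \<notin> N"
    unfolding lborel_prod using N by (intro AE_not_in) (auto simp: null_sets_def)
  then have "AE x in lborel. AE y in lborel. (x, y) \<notin> N"
    by (rule lborel_pair.AE_pair)
  moreover have "{z \<in> space (lborel \<Otimes>\<^sub>M lborel). (fst z, snd z) \<notin> N} \<in> sets (lborel \<Otimes>\<^sub>M lborel)"
  proof -
    have "{z \<in> space (lborel \<Otimes>\<^sub>M lborel). (fst z, snd z) \<notin> N} = space (lborel \<Otimes>\<^sub>M lborel) - N"
      by auto
    also have "\<dots> \<in> sets (lborel \<Otimes>\<^sub>M lborel)"
      using N(3) unfolding lborel_prod by (rule sets.compl_sets)
    finally show ?thesis .
  qed
  ultimately have "AE y in lborel. AE x in lborel. (x, y) \<notin> N"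
    using lborel_pair.AE_commute[of "\<lambda>x y. (x, y) \<notin> N"] by blast
  then show ?thesis
    by eventually_elim (use N(1) in \<open>auto elim!: eventually_mono\<close>)
qed

section \<open>Essential suprema and their dependence on a parameter\<close>

lemma AE_lebesgue_on_iff:
  assumes "S \<in> sets borel"
  shows "(AE x in lebesgue_on S. Q x) \<longleftrightarrow> (AE x in lborel. x \<in> S \<longrightarrow> Q x)"
  using assms by (subst AE_restrict_space_iff) (auto simp: AE_completion_iff)

lemma Linf_norm_le: "AE x in lebesgue_on {0..1}. u x \<le> c \<Longrightarrow> Linf_norm u \<le> c"
  unfolding Linf_norm_def by (rule Inf_lower) simp

lemma Linf_norm_cong_AE:
  assumes "AE x in lebesgue_on {0..1}. u x = v x"
  shows "Linf_norm u = Linf_norm v"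
proof -
  have "(AE x in lebesgue_on {0..1}. u x \<le> c) \<longleftrightarrow> (AE x in lebesgue_on {0..1}. v x \<le> c)" for c
    using assms by (intro eventually_cong) auto
  then show ?thesis by (simp add: Linf_norm_def)
qed

lemma AE_le_Linf_norm:
  assumes "u \<in> borel_measurable (lebesgue_on {0..1})"
  shows "AE x in lebesgue_on {0..1}. u x \<le> Linf_norm u"
  unfolding Linf_norm_eq_esssup[OF assms] by (rule esssup_AE)

text \<open>The norm is at most c exactly when the part of [0, 1] where g exceeds c is null. The
  measure of that part is an integral with parameter p, hence Borel in p.\<close>

lemma measurable_Linf_norm:
  fixes g :: "real \<Rightarrow> real ^ 3 \<Rightarrow> ennreal"
  assumes [measurable]: "(\<lambda>(x, p). g x p) \<in> borel_measurable (borel \<Otimes>\<^sub>M borel)"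
  shows "(\<lambda>p. Linf_norm (\<lambda>x. g x p)) \<in> borel_measurable borel"
proof (rule borel_measurableI_le)
  fix c :: ennreal
  have *: "Linf_norm (\<lambda>x. g x p) \<le> c \<longleftrightarrow>
      (\<integral>\<^sup>+x. indicator {0..1} x * indicator {c<..} (g x p) \<partial>lborel) = 0" for p
  proof -
    have "(\<lambda>x. g x p) \<in> borel_measurable borel" by measurable
    then have "(\<lambda>x. g x p) \<in> borel_measurable (lebesgue_on {0..1})"
      by (intro measurable_restrict_space1 measurable_completion) simp
    from AE_le_Linf_norm[OF this]
    have "Linf_norm (\<lambda>x. g x p) \<le> c \<longleftrightarrow> (AE x in lebesgue_on {0..1}. g x p \<le> c)"
      by (auto intro: Linf_norm_le elim: eventually_mono)
    also have "\<dots> \<longleftrightarrow> (AE x in lborel. indicator {0..1} x * indicator {c<..} (g x p) = (0 :: ennreal))"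
      by (subst AE_lebesgue_on_iff) (auto simp: indicator_def not_less intro!: eventually_cong)
    also have "\<dots> \<longleftrightarrow> (\<integral>\<^sup>+x. indicator {0..1} x * indicator {c<..} (g x p) \<partial>lborel) = 0"
      by (rule nn_integral_0_iff_AE[symmetric]) measurable
    finally show ?thesis .
  qed
  show "{p \<in> space borel. Linf_norm (\<lambda>x. g x p) \<le> c} \<in> sets borel"
    unfolding * by measurable
qed

text \<open>Sections of f may be non-measurable, so F is formed from a Borel representative of f.
  The bound by F is first known for each p and almost every x; Tonelli gathers the exceptions into
  one null set N of pairs, which can then be tracked through collisions.\<close>

lemma borel_majorant:
  fixes f :: "real \<Rightarrow> real ^ 3 \<Rightarrow> real"
  assumes f: "(\<lambda>(x, p). f x p) \<in> borel_measurable (lebesgue_on ({0..1} \<times> UNIV))"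
  obtains F N where "F \<in> borel_measurable borel"
    and "N \<in> null_sets (lborel :: (real \<times> (real ^ 3)) measure)"
    and "\<And>x p. x \<in> {0..1} \<Longrightarrow> (x, p) \<notin> N \<Longrightarrow> ennreal \<bar>f x p\<bar> \<le> F p"
    and "AE p in lborel. F p = Linf_norm (\<lambda>x. ennreal \<bar>f x p\<bar>)"
proof -
  let ?S = "{0..1} \<times> UNIV :: (real \<times> (real ^ 3)) set"
  have S: "?S \<in> sets lebesgue"
    by (intro lebesgue_closedin[of UNIV, simplified] closed_Times) auto
  have "(\<lambda>z. if z \<in> ?S then (case z of (x, p) \<Rightarrow> f x p) else 0) \<in> borel_measurable lebesgue"
    using f S by (simp add: borel_measurable_if)
  then obtain g where g [measurable]: "g \<in> borel_measurable (lborel :: (real \<times> (real ^ 3)) measure)"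
    and fg: "AE z in lborel. (if z \<in> ?S then (case z of (x, p) \<Rightarrow> f x p) else 0) = g z"
    by (blast dest: completion_ex_borel_measurable_real)
  have fg: "AE z in lborel. fst z \<in> {0..1} \<longrightarrow> f (fst z) (snd z) = g z"
    using fg by eventually_elim (auto split: if_splits prod.splits)
  have [measurable]: "g \<in> borel_measurable (borel \<Otimes>\<^sub>M borel)" using g by (simp add: borel_prod)
  define F where "F = (\<lambda>p. Linf_norm (\<lambda>x. ennreal \<bar>g (x, p)\<bar>))"
  have F [measurable]: "F \<in> borel_measurable borel"
    unfolding F_def by (rule measurable_Linf_norm) measurable
  have "AE x in lborel. x \<in> {0..1} \<longrightarrow> ennreal \<bar>g (x, p)\<bar> \<le> F p" for p
  proof -
    have "(\<lambda>x. ennreal \<bar>g (x, p)\<bar>) \<in> borel_measurable borel" by measurable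
    then have "(\<lambda>x. ennreal \<bar>g (x, p)\<bar>) \<in> borel_measurable (lebesgue_on {0..1})"
      by (intro measurable_restrict_space1 measurable_completion) simp
    from AE_le_Linf_norm[OF this] show ?thesis
      by (simp add: AE_lebesgue_on_iff F_def)
  qed
  then have "AE p in lborel. AE x in lborel. x \<in> {0..1} \<longrightarrow> ennreal \<bar>g (x, p)\<bar> \<le> F p" by simp
  moreover have meas: "{z \<in> space (lborel \<Otimes>\<^sub>M lborel). fst z \<in> {0..1} \<longrightarrow> ennreal \<bar>g (fst z, snd z)\<bar> \<le> F (snd z)}
      \<in> sets (lborel \<Otimes>\<^sub>M lborel)"
    by measurable
  ultimately have "AE x in lborel. AE p in lborel. x \<in> {0..1} \<longrightarrow> ennreal \<bar>g (x, p)\<bar> \<le> F p"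
    using lborel_pair.AE_commute[of "\<lambda>x p. x \<in> {0..1} \<longrightarrow> ennreal \<bar>g (x, p)\<bar> \<le> F p"] by blast
  then have "AE z in lborel \<Otimes>\<^sub>M lborel. fst z \<in> {0..1} \<longrightarrow> ennreal \<bar>g (fst z, snd z)\<bar> \<le> F (snd z)"
    using lborel_pair.AE_pair_measure[OF meas] by simp
  then have "AE z in lborel. fst z \<in> {0..1} \<longrightarrow> ennreal \<bar>g z\<bar> \<le> F (snd z)"
    unfolding lborel_prod by simp
  with fg have "AE z in lborel. fst z \<in> {0..1} \<longrightarrow> ennreal \<bar>f (fst z) (snd z)\<bar> \<le> F (snd z)"
    by eventually_elim auto
  then obtain N where N: "{z \<in> space lborel. \<not> (fst z \<in> {0..1} \<longrightarrow> ennreal \<bar>f (fst z) (snd z)\<bar> \<le> F (snd z))} \<subseteq> N"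
      "emeasure lborel N = 0" "N \<in> sets lborel"
    by (rule AE_E)
  show thesis
  proof (rule that[of F N])
    show "N \<in> null_sets lborel" using N by (auto simp: null_sets_def)
    show "ennreal \<bar>f x p\<bar> \<le> F p" if "x \<in> {0..1}" "(x, p) \<notin> N" for x p
    proof -
      have "(x, p) \<notin> {z \<in> space lborel. \<not> (fst z \<in> {0..1} \<longrightarrow> ennreal \<bar>f (fst z) (snd z)\<bar> \<le> F (snd z))}"
        using N(1) that(2) by blast
      then show ?thesis using that(1) by simp
    qed
    \<comment> \<open>On almost every section f and its representative agree almost everywhere, so
      their essential suprema coincide.\<close>
    have "AE p in lborel. AE x in lborel. fst (x, p) \<in> {0..1} \<longrightarrow> f (fst (x, p)) (snd (x, p)) = g (x, p)"
      using fg by (rule AE_lborel_pair_swap)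
    then show "AE p in lborel. F p = Linf_norm (\<lambda>x. ennreal \<bar>f x p\<bar>)"
    proof eventually_elim
      fix p assume "AE x in lborel. fst (x, p) \<in> {0..1} \<longrightarrow> f (fst (x, p)) (snd (x, p)) = g (x, p)"
      then show "F p = Linf_norm (\<lambda>x. ennreal \<bar>f x p\<bar>)"
        unfolding F_def
        by (intro Linf_norm_cong_AE) (auto simp: AE_lebesgue_on_iff elim!: eventually_mono)
    qed
  qed (rule F)
qed

text \<open>\<open>f\<close> agrees with a Borel function only up to a null set, while for fixed \<open>p\<close> the points \<open>p'\<close> and
  \<open>q'\<close> range over lower-dimensional sets. The change of variables shows that the exceptional null
  set is nevertheless avoided.\<close>

lemma AE_post_not_in_null_set:
  assumes N: "N \<in> null_sets (lborel :: (real \<times> (real ^ 3)) measure)"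
  shows "AE p in lborel. AE x in lborel. AE q in lborel. AE \<omega> in sphere_measure.
    moller_velocity p q = 0 \<or> (x, post_p p q \<omega>) \<notin> N \<and> (x, post_q p q \<omega>) \<notin> N"
proof -
  have [measurable]: "N \<in> sets (borel \<Otimes>\<^sub>M borel)"
    using N unfolding borel_prod null_sets_def by simp
  \<comment> \<open>The v-weighted mass of the collisions of p for which p' or q' meets N at x.
    Because of the weight, the conclusion exempts v = 0, where the integrand of the gain vanishes
    anyway.\<close>
  define H where "H = (\<lambda>x p. \<integral>\<^sup>+q. (\<integral>\<^sup>+\<omega>. ennreal (moller_velocity p q) *
      (indicator N (x, post_p p q \<omega>) + indicator N (x, post_q p q \<omega>)) \<partial>sphere_measure) \<partial>lborel)"
  have [measurable]: "(\<lambda>(x, p). H x p) \<in> borel_measurable (borel \<Otimes>\<^sub>M borel)"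
    unfolding H_def by measurable
  have "AE z in lborel \<Otimes>\<^sub>M lborel. z \<notin> N"
    unfolding lborel_prod using N by (rule AE_not_in)
  then have "AE x in lborel. AE p in lborel. (x, p) \<notin> N"
    by (rule lborel_pair.AE_pair)
  then have "AE x in lborel. AE p in lborel. H x p = 0"
  proof eventually_elim
    fix x assume x: "AE p in lborel. (x, p) \<notin> N"
    \<comment> \<open>K reads only its second pair, so the exchange evaluates it at p and q
      themselves, which avoid the null section for almost every p and q.\<close>
    define K where "K = (\<lambda>(a :: (real ^ 3) \<times> (real ^ 3), (p, q)). indicator N (x, p) + indicator N (x, q) :: ennreal)"
    have [measurable]: "K \<in> borel_measurable ((borel \<Otimes>\<^sub>M borel) \<Otimes>\<^sub>M (borel \<Otimes>\<^sub>M borel))"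
      unfolding K_def by measurable
    have "(\<integral>\<^sup>+p. H x p \<partial>lborel) = (\<integral>\<^sup>+p. (\<integral>\<^sup>+q. (\<integral>\<^sup>+\<omega>. ennreal (moller_velocity p q)
            * K ((p, q), (post_p p q \<omega>, post_q p q \<omega>)) \<partial>sphere_measure) \<partial>lborel) \<partial>lborel)"
      by (simp add: H_def K_def)
    also have "\<dots> = (\<integral>\<^sup>+p. (\<integral>\<^sup>+q. (\<integral>\<^sup>+\<omega>. ennreal (moller_velocity p q)
            * K ((post_p p q \<omega>, post_q p q \<omega>), (p, q)) \<partial>sphere_measure) \<partial>lborel) \<partial>lborel)"
      by (rule collision_change_of_variables) measurable
    also have "\<dots> = (\<integral>\<^sup>+p. 0 \<partial>(lborel :: (real ^ 3) measure))"
    proof (rule nn_integral_cong_AE, use x in eventually_elim)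
      fix p assume p: "(x, p) \<notin> N"
      have "(\<integral>\<^sup>+q. (\<integral>\<^sup>+\<omega>. ennreal (moller_velocity p q)
          * K ((post_p p q \<omega>, post_q p q \<omega>), (p, q)) \<partial>sphere_measure) \<partial>lborel) =
          (\<integral>\<^sup>+q. 0 \<partial>(lborel :: (real ^ 3) measure))"
        by (rule nn_integral_cong_AE) (use x in \<open>eventually_elim, simp add: K_def p\<close>)
      then show "(\<integral>\<^sup>+q. (\<integral>\<^sup>+\<omega>. ennreal (moller_velocity p q)
          * K ((post_p p q \<omega>, post_q p q \<omega>), (p, q)) \<partial>sphere_measure) \<partial>lborel) = 0"
        by simp
    qed
    finally have "(\<integral>\<^sup>+p. H x p \<partial>lborel) = 0" by simp
    then show "AE p in lborel. H x p = 0"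
      by (subst (asm) nn_integral_0_iff_AE) auto
  qed
  moreover have "{z \<in> space (lborel \<Otimes>\<^sub>M lborel). H (fst z) (snd z) = 0} \<in> sets (lborel \<Otimes>\<^sub>M lborel)"
    by measurable
  ultimately have "AE p in lborel. AE x in lborel. H x p = 0"
    using lborel_pair.AE_commute[of "\<lambda>x p. H x p = 0"] by blast
  then show ?thesis
  proof eventually_elim
    fix p assume "AE x in lborel. H x p = 0"
    then show "AE x in lborel. AE q in lborel. AE \<omega> in sphere_measure.
      moller_velocity p q = 0 \<or> (x, post_p p q \<omega>) \<notin> N \<and> (x, post_q p q \<omega>) \<notin> N"
    proof eventually_elim
      fix x assume "H x p = 0"
      then have "AE q in lborel. (\<integral>\<^sup>+\<omega>. ennreal (moller_velocity p q) *
          (indicator N (x, post_p p q \<omega>) + indicator N (x, post_q p q \<omega>)) \<partial>sphere_measure) = 0"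
        unfolding H_def by (subst (asm) nn_integral_0_iff_AE) auto
      then show "AE q in lborel. AE \<omega> in sphere_measure.
          moller_velocity p q = 0 \<or> (x, post_p p q \<omega>) \<notin> N \<and> (x, post_q p q \<omega>) \<notin> N"
      proof eventually_elim
        fix q assume "(\<integral>\<^sup>+\<omega>. ennreal (moller_velocity p q) *
          (indicator N (x, post_p p q \<omega>) + indicator N (x, post_q p q \<omega>)) \<partial>sphere_measure) = 0"
        then have "AE \<omega> in sphere_measure. ennreal (moller_velocity p q) *
          (indicator N (x, post_p p q \<omega>) + indicator N (x, post_q p q \<omega>)) = 0"
          by (subst (asm) nn_integral_0_iff_AE) auto
        then show "AE \<omega> in sphere_measure.
          moller_velocity p q = 0 \<or> (x, post_p p q \<omega>) \<notin> N \<and> (x, post_q p q \<omega>) \<notin> N"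
          by eventually_elim
            (use moller_velocity_nonneg[of p q] in \<open>auto simp: indicator_eq_0_iff ennreal_eq_0_iff\<close>)
      qed
    qed
  qed
qed

section \<open>Domination of the gain operator\<close>

text \<open>The integrand of the gain, built from Lebesgue measurable data, may fail to be
  measurable in q and \<omega>. A bound almost everywhere in each variable suffices, since
  monotonicity of the integral holds for arbitrary integrands.\<close>

lemma gain_le:
  assumes \<sigma>: "\<And>g \<theta>. 0 \<le> g \<Longrightarrow> \<theta> \<in> {0..pi} \<Longrightarrow> 0 \<le> \<sigma> g \<theta> \<and> \<sigma> g \<theta> \<le> D * g"
    and x: "x \<in> {0..1}"
    and f: "\<And>p. 0 \<le> f x p"
    and F: "\<And>p. (x, p) \<notin> N \<Longrightarrow> ennreal \<bar>f x p\<bar> \<le> F p"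
    and D: "0 \<le> D"
    and ae: "AE q in lborel. AE \<omega> in sphere_measure.
      moller_velocity p q = 0 \<or> (x, post_p p q \<omega>) \<notin> N \<and> (x, post_q p q \<omega>) \<notin> N"
  shows "gain \<sigma> f f x p \<le> (\<integral>\<^sup>+q. (\<integral>\<^sup>+\<omega>. ennreal D * (ennreal (moller_velocity p q * rel_momentum p q) *
          (F (post_p p q \<omega>) * F (post_q p q \<omega>))) \<partial>sphere_measure) \<partial>lborel)"
  unfolding gain_def nn_integral_completion
proof (rule nn_integral_mono_AE, use ae AE_lborel_singleton[of p] in eventually_elim)
  fix q
  assume pq: "q \<noteq> p"
  assume "AE \<omega> in sphere_measure.
      moller_velocity p q = 0 \<or> (x, post_p p q \<omega>) \<notin> N \<and> (x, post_q p q \<omega>) \<notin> N"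
  then have "AE \<omega> in sphere_measure. ennreal (moller_velocity p q
        * \<sigma> (rel_momentum p q) (scattering_angle p q \<omega>)
        * f x (post_p p q \<omega>) * f x (post_q p q \<omega>)) \<le>
      ennreal D * (ennreal (moller_velocity p q * rel_momentum p q) *
          (F (post_p p q \<omega>) * F (post_q p q \<omega>)))"
    using AE_space
  proof eventually_elim
    fix \<omega>
    let ?v = "moller_velocity p q" and ?g = "rel_momentum p q" and ?\<theta> = "scattering_angle p q \<omega>"
    assume *: "?v = 0 \<or> (x, post_p p q \<omega>) \<notin> N \<and> (x, post_q p q \<omega>) \<notin> N"
      and "\<omega> \<in> space sphere_measure"
    \<comment> \<open>The bounds on \<sigma> apply for \<theta> in [0, \<pi>], and p \<noteq> q
      guarantees this range.\<close>
    then have \<theta>: "?\<theta> \<in> {0..pi}"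
      using pq by (intro scattering_angle_bounds norm_sphere_measure) auto
    note \<sigma>' = \<sigma>[OF rel_momentum_nonneg[of p q] \<theta>]
    show "ennreal (?v * \<sigma> ?g ?\<theta> * f x (post_p p q \<omega>) * f x (post_q p q \<omega>)) \<le>
      ennreal D * (ennreal (?v * ?g) * (F (post_p p q \<omega>) * F (post_q p q \<omega>)))"
    proof (cases "?v = 0")
      case False
      have "ennreal (?v * \<sigma> ?g ?\<theta> * f x (post_p p q \<omega>) * f x (post_q p q \<omega>)) =
          ennreal (?v * \<sigma> ?g ?\<theta>) * (ennreal \<bar>f x (post_p p q \<omega>)\<bar> * ennreal \<bar>f x (post_q p q \<omega>)\<bar>)"
        using \<sigma>' f moller_velocity_nonneg[of p q] by (simp add: ennreal_mult mult.assoc)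
      also have "\<dots> \<le> ennreal (D * (?v * ?g)) * (F (post_p p q \<omega>) * F (post_q p q \<omega>))"
      proof (rule mult_mono)
        show "ennreal (?v * \<sigma> ?g ?\<theta>) \<le> ennreal (D * (?v * ?g))"
          using mult_left_mono[OF conjunct2[OF \<sigma>'] moller_velocity_nonneg[of p q]]
          by (intro ennreal_leI) (simp add: mult_ac)
        show "ennreal \<bar>f x (post_p p q \<omega>)\<bar> * ennreal \<bar>f x (post_q p q \<omega>)\<bar> \<le> F (post_p p q \<omega>) * F (post_q p q \<omega>)"
          using * False by (intro mult_mono F) auto
      qed simp_all
      also have "\<dots> = ennreal D * (ennreal (?v * ?g) * (F (post_p p q \<omega>) * F (post_q p q \<omega>)))"
        using D by (simp add: ennreal_mult' mult.assoc)
      finally show ?thesis .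
    qed simp
  qed
  then show "(\<integral>\<^sup>+\<omega>. ennreal (moller_velocity p q
        * \<sigma> (rel_momentum p q) (scattering_angle p q \<omega>)
        * f x (post_p p q \<omega>) * f x (post_q p q \<omega>)) \<partial>sphere_measure) \<le>
      (\<integral>\<^sup>+\<omega>. ennreal D * (ennreal (moller_velocity p q * rel_momentum p q) *
          (F (post_p p q \<omega>) * F (post_q p q \<omega>))) \<partial>sphere_measure)"
    by (rule nn_integral_mono_AE)
qed

theorem proposition3p1:
  fixes \<sigma> :: "real \<Rightarrow> real \<Rightarrow> real" and \<sigma>0 :: "real \<Rightarrow> real" and c0 :: real
  assumes "hard_sphere_kernel \<sigma> \<sigma>0 c0"
  shows "\<exists>C::real. C > 0 \<and>
    (\<forall>k>0. \<forall>f :: real \<Rightarrow> real ^ 3 \<Rightarrow> real. \<forall>a :: real ^ 3.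
       (\<lambda>(x, p). f x p) \<in> borel_measurable (lebesgue_on ({0..1} \<times> UNIV)) \<longrightarrow>
       (\<forall>x\<in>{0..1}. \<forall>p. 0 \<le> f x p) \<longrightarrow>
       (\<integral>\<^sup>+p. ennreal (weight k p / norm (p - a))
           * Linf_norm (\<lambda>x. gain \<sigma> f f x p) \<partial>lebesgue)
         \<le> ennreal C * (weighted_norm k f)\<^sup>2)"
proof -
  have \<sigma>_nonneg: "\<forall>g\<ge>0. \<forall>\<theta>\<in>{0..pi}. 0 \<le> \<sigma> g \<theta>"
    and \<sigma>0_bounds: "\<forall>\<theta>\<in>{0..pi}. 0 \<le> \<sigma>0 \<theta> \<and> \<sigma>0 \<theta> \<le> 1 / (4 * pi)"
    and ex: "\<exists>c1>0. \<exists>c2>0. \<forall>g\<ge>0. \<forall>\<theta>\<in>{0..pi}.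
        c1 * (g * \<sigma>0 \<theta>) \<le> \<sigma> g \<theta> \<and> \<sigma> g \<theta> \<le> c2 * (g * \<sigma>0 \<theta>)"
    using assms unfolding hard_sphere_kernel_def by simp_all
  from ex obtain c2 where c2: "c2 > 0"
    and \<sigma>_le: "\<And>g \<theta>. 0 \<le> g \<Longrightarrow> \<theta> \<in> {0..pi} \<Longrightarrow> \<sigma> g \<theta> \<le> c2 * (g * \<sigma>0 \<theta>)"
    by metis
  \<comment> \<open>The factor 1 / (4 \<pi>) is the upper bound on \<sigma>0, which leaves \<sigma>
    \<le> D g.\<close>
  define D where "D = c2 / (4 * pi)"
  have D: "D > 0" using c2 by (simp add: D_def)
  have \<sigma>: "0 \<le> \<sigma> g \<theta> \<and> \<sigma> g \<theta> \<le> D * g" if "0 \<le> g" "\<theta> \<in> {0..pi}" for g \<theta>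
  proof -
    have "c2 * (g * \<sigma>0 \<theta>) \<le> c2 * (g * (1 / (4 * pi)))"
      using that c2 \<sigma>0_bounds by (intro mult_left_mono) auto
    then show ?thesis using \<sigma>_le[OF that] \<sigma>_nonneg that by (simp add: D_def)
  qed
  obtain A where A: "A > 0"
    "\<And>b :: real ^ 3. (\<integral>\<^sup>+\<omega>. ennreal (1 / norm (\<omega> - b)) \<partial>sphere_measure) \<le> ennreal A"
    using angular_potential_bounded by blast
  \<comment> \<open>A is purely geometric and D depends on the kernel through c2, so the constant is
    fixed before k, f and a.\<close>
  have "(\<integral>\<^sup>+p. ennreal (weight k p / norm (p - a)) * Linf_norm (\<lambda>x. gain \<sigma> f f x p) \<partial>lebesgue)
         \<le> ennreal (D * (8 * A)) * (weighted_norm k f)\<^sup>2"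
    if k: "k > 0" and f: "(\<lambda>(x, p). f x p) \<in> borel_measurable (lebesgue_on ({0..1} \<times> UNIV))"
      and f0: "\<forall>x\<in>{0..1}. \<forall>p. 0 \<le> f x p" for k f and a :: "real ^ 3"
  proof -
    obtain F N where F [measurable]: "F \<in> borel_measurable borel"
      and N: "N \<in> null_sets (lborel :: (real \<times> (real ^ 3)) measure)"
      and FN: "\<And>x p. x \<in> {0..1} \<Longrightarrow> (x, p) \<notin> N \<Longrightarrow> ennreal \<bar>f x p\<bar> \<le> F p"
      and FL: "AE p in lborel. F p = Linf_norm (\<lambda>x. ennreal \<bar>f x p\<bar>)"
      using borel_majorant[OF f] by blast
    \<comment> \<open>Up to the factor D, a Borel majorant of the gain that is free of x; the
      supremum over x has been absorbed into F.\<close>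
    define G where "G = (\<lambda>p. \<integral>\<^sup>+q. (\<integral>\<^sup>+\<omega>. ennreal (moller_velocity p q * rel_momentum p q) *
          (F (post_p p q \<omega>) * F (post_q p q \<omega>)) \<partial>sphere_measure) \<partial>lborel)"
    have [measurable]: "G \<in> borel_measurable borel" unfolding G_def by measurable
    have "AE p in lborel. Linf_norm (\<lambda>x. gain \<sigma> f f x p) \<le> ennreal D * G p"
      using AE_post_not_in_null_set[OF N]
    proof eventually_elim
      fix p assume "AE x in lborel. AE q in lborel. AE \<omega> in sphere_measure.
        moller_velocity p q = 0 \<or> (x, post_p p q \<omega>) \<notin> N \<and> (x, post_q p q \<omega>) \<notin> N"
      then have "AE x in lborel. x \<in> {0..1} \<longrightarrow> gain \<sigma> f f x p \<le> ennreal D * G p"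
      proof eventually_elim
        fix x assume ae: "AE q in lborel. AE \<omega> in sphere_measure.
          moller_velocity p q = 0 \<or> (x, post_p p q \<omega>) \<notin> N \<and> (x, post_q p q \<omega>) \<notin> N"
        show "x \<in> {0..1} \<longrightarrow> gain \<sigma> f f x p \<le> ennreal D * G p"
        proof
          assume x: "x \<in> {0..1}"
          have "gain \<sigma> f f x p \<le> (\<integral>\<^sup>+q. (\<integral>\<^sup>+\<omega>. ennreal D * (ennreal (moller_velocity p q * rel_momentum p q) *
            (F (post_p p q \<omega>) * F (post_q p q \<omega>))) \<partial>sphere_measure) \<partial>lborel)"
            using \<sigma> x f0 FN[OF x] D ae by (intro gain_le[where N = N]) auto
          also have "\<dots> = ennreal D * G p"
            by (simp add: G_def nn_integral_cmult)
          finally show "gain \<sigma> f f x p \<le> ennreal D * G p" .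
        qed
      qed
      then show "Linf_norm (\<lambda>x. gain \<sigma> f f x p) \<le> ennreal D * G p"
        by (intro Linf_norm_le) (simp add: AE_lebesgue_on_iff)
    qed
    then have "(\<integral>\<^sup>+p. ennreal (weight k p / norm (p - a)) * Linf_norm (\<lambda>x. gain \<sigma> f f x p) \<partial>lebesgue) \<le>
        (\<integral>\<^sup>+p. ennreal (weight k p / norm (p - a)) * (ennreal D * G p) \<partial>lborel)"
      unfolding nn_integral_completion
      by (intro nn_integral_mono_AE) (auto elim!: eventually_mono intro: mult_left_mono)
    also have "\<dots> = (\<integral>\<^sup>+p. ennreal D * (ennreal (weight k p / norm (p - a)) * G p) \<partial>lborel)"
      by (simp only: mult.left_commute)
    also have "\<dots> = ennreal D * (\<integral>\<^sup>+p. ennreal (weight k p / norm (p - a)) * G p \<partial>lborel)"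
    proof (rule nn_integral_cmult)
      have "(\<lambda>p. ennreal (weight k p / norm (p - a)) * G p) \<in> borel_measurable borel" by measurable
      then show "(\<lambda>p. ennreal (weight k p / norm (p - a)) * G p) \<in> borel_measurable lborel" by simp
    qed
    also have "\<dots> \<le> ennreal D * (ennreal (8 * A) * (\<integral>\<^sup>+p. ennreal (weight k p) * F p \<partial>lborel)\<^sup>2)"
      unfolding G_def using A k by (intro mult_left_mono weighted_gain_estimate) auto
    also have "\<dots> \<le> ennreal D * (ennreal (8 * A) * (weighted_norm k f)\<^sup>2)"
    proof (intro mult_left_mono power_mono)
      show "(\<integral>\<^sup>+p. ennreal (weight k p) * F p \<partial>lborel) \<le> weighted_norm k f"
        unfolding weighted_norm_def nn_integral_completion
      proof (rule nn_integral_mono_AE, use FL in eventually_elim)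
        fix p assume Fp: "F p = Linf_norm (\<lambda>x. ennreal \<bar>f x p\<bar>)"
        have "weight k p \<le> sqrt (energy p) * weight k p"
          using mult_right_mono[of 1 "sqrt (energy p)" "weight k p"] weight_pos[of k p] energy_ge_1[of p] by simp
        then show "ennreal (weight k p) * F p \<le>
            ennreal (sqrt (energy p) * weight k p) * Linf_norm (\<lambda>x. ennreal \<bar>f x p\<bar>)"
          unfolding Fp by (intro mult_right_mono ennreal_leI) auto
      qed
    qed auto
    also have "\<dots> = ennreal (D * (8 * A)) * (weighted_norm k f)\<^sup>2"
      using D A(1) by (simp add: ennreal_mult mult.assoc)
    finally show ?thesis .
  qed
  moreover have "D * (8 * A) > 0" using D A(1) by simp
  ultimately show ?thesis by blast
qed

end
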